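(* Let $X$ be a Banach space and let $(X_n)_{n=1}^\infty$ be an unconditional finite-dimensional decomposition (FDD) of $X$. Assume that $(X_n)_{n=1}^\infty$ has property $(\#')$ and that $(X_n)_{n=1}^\infty$ has a disjoint lower $p$ estimate for some $p<\infty$. Then $X$ has the SHAI property; that is, for every non-zero Banach space $Y$, every surjective algebra homomorphism from $\mathcal{L}(X)$ onto $\mathcal{L}(Y)$ is injective.
   Context: Banach spaces are over the reals. $\mathcal{L}(X)$ is the algebra of bounded linear operators on $X$; algebra homomorphisms are linear and multiplicative (no continuity is assumed). $[S]$ denotes the closed linear span of $S$. $\mathfrak{c}$ is the cardinality of the continuum. A family $(X_n)_{n=1}^\infty$ of closed subspaces of $X$ is an unconditional Schauder decomposition of $X$ if every $x\in X$ has a unique representation $x=\sum_n x_n$ with $x_n\in X_n$ for all $n$, the convergence being unconditional; it is an unconditional FDD if moreover each $X_n$ is finite-dimensional. The associated bounded projections are $P_m\big(\sum_n x_n\big)=x_m$. Property $(\#')$: there is a family $\{N_\gamma:\gamma<\mathfrak{c}\}$ of infinite subsets of $\mathbb{N}$ that is almost disjoint ($N_\gamma\cap N_\delta$ is finite whenever $\gamma\ne\delta$) such that for each $\gamma<\mathfrak{c}$ the space $X$ is isomorphic (linearly homeomorphic) to a complemented subspace of $\big[\bigcup_{n\in N_\gamma}X_n\big]$. Disjoint lower $p$ estimate ($0<p<\infty$): there is $C<\infty$ such that whenever $x_1,\dots,x_k\in X$ are finitely many vectors such that for every $n\in\mathbb{N}$ there is at most one $i\in\{1,\dots,k\}$ with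 $P_nx_i\neq0$, one has $\big\|\sum_{i=1}^k x_i\big\|\ge \frac1C\big(\sum_{i=1}^k\|x_i\|^p\big)^{1/p}$. *)

theory Defs
  imports "HOL-Analysis.Analysis"
begin

definition schauder_decomposition :: "(nat \<Rightarrow> 'a::banach set) \<Rightarrow> bool" where
  "schauder_decomposition X \<longleftrightarrow>
     (\<forall>n. subspace (X n) \<and> closed (X n)) \<and>
     (\<forall>x. \<exists>!u. (\<forall>n. u n \<in> X n) \<and> u sums x)"

text \<open>Uniqueness above is among all (possibly conditionally) convergent expansions.
  Unconditional convergence is rendered as convergence of the net of finite partial
  sums, \<^const>\<open>has_sum\<close>.\<close>

definition unconditional_schauder_decomposition :: "(nat \<Rightarrow> 'a::banach set) \<Rightarrow> bool" where
  "unconditional_schauder_decomposition X \<longleftrightarrow>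
     schauder_decomposition X \<and>
     (\<forall>x u. (\<forall>n. u n \<in> X n) \<and> u sums x \<longrightarrow> (u has_sum x) UNIV)"

definition unconditional_FDD :: "(nat \<Rightarrow> 'a::banach set) \<Rightarrow> bool" where
  "unconditional_FDD X \<longleftrightarrow>
     unconditional_schauder_decomposition X \<and>
     (\<forall>n. \<exists>B. finite B \<and> X n = span B)"

definition decomposition_proj :: "(nat \<Rightarrow> 'a::banach set) \<Rightarrow> nat \<Rightarrow> 'a \<Rightarrow> 'a" where
  "decomposition_proj X m x = (THE u. (\<forall>n. u n \<in> X n) \<and> u sums x) m"

definition closed_span :: "'a::real_normed_vector set \<Rightarrow> 'a set" where
  "closed_span S = closure (span S)"

text \<open>\<open>W\<close> is the range of a bounded linear projection on the subspace \<open>Z\<close>. The projection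
  is only required to be linear and bounded on \<open>Z\<close>; its values elsewhere are irrelevant.\<close>

definition complemented_in :: "'a::real_normed_vector set \<Rightarrow> 'a set \<Rightarrow> bool" where
  "complemented_in W Z \<longleftrightarrow>
     (\<exists>Q K. (\<forall>x\<in>Z. \<forall>y\<in>Z. Q (x + y) = Q x + Q y) \<and>
            (\<forall>c. \<forall>x\<in>Z. Q (c *\<^sub>R x) = c *\<^sub>R Q x) \<and>
            (\<forall>x\<in>Z. norm (Q x) \<le> K * norm x) \<and>
            Q ` Z = W \<and> W \<subseteq> Z \<and> (\<forall>w\<in>W. Q w = w))"

definition space_isomorphic_to :: "'a::real_normed_vector set \<Rightarrow> bool" where
  "space_isomorphic_to W \<longleftrightarrow>
     (\<exists>T T'. linear (T :: 'a \<Rightarrow> 'a) \<and> homeomorphism UNIV W T T')"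

text \<open>The index type \<^typ>\<open>real\<close> serves as an index set of cardinality continuum.\<close>

definition property_sharp' :: "(nat \<Rightarrow> 'a::banach set) \<Rightarrow> bool" where
  "property_sharp' X \<longleftrightarrow>
     (\<exists>N :: real \<Rightarrow> nat set.
        (\<forall>\<gamma>. infinite (N \<gamma>)) \<and>
        (\<forall>\<gamma> \<delta>. \<gamma> \<noteq> \<delta> \<longrightarrow> finite (N \<gamma> \<inter> N \<delta>)) \<and>
        (\<forall>\<gamma>. \<exists>W. complemented_in W (closed_span (\<Union>n\<in>N \<gamma>. X n)) \<and>
                 space_isomorphic_to W))"

definition disjoint_lower_estimate :: "(nat \<Rightarrow> 'a::banach set) \<Rightarrow> real \<Rightarrow> bool" where
  "disjoint_lower_estimate X p \<longleftrightarrow>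
     (\<exists>C>0. \<forall>(k::nat) (x :: nat \<Rightarrow> 'a).
        (\<forall>n. \<exists>\<^sub>\<le>\<^sub>1 i. i < k \<and> decomposition_proj X n (x i) \<noteq> 0) \<longrightarrow>
        norm (\<Sum>i<k. x i) \<ge> 1 / C * (\<Sum>i<k. norm (x i) powr p) powr (1 / p))"

definition algebra_hom ::
  "(('a::real_normed_vector \<Rightarrow>\<^sub>L 'a) \<Rightarrow> ('b::real_normed_vector \<Rightarrow>\<^sub>L 'b)) \<Rightarrow> bool" where
  "algebra_hom h \<longleftrightarrow> linear h \<and> (\<forall>S T. h (S o\<^sub>L T) = h S o\<^sub>L h T)"

end

theory Submission
  imports Defs
begin

text \<open>
  Suppose \<open>h\<close> is a non-injective homomorphism of \<open>L(X)\<close> onto \<open>L(Y)\<close>. It is automatically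
  continuous and open, and its kernel contains all finite rank operators. Hence the band
  projections onto \<open>[X n : n \<in> N \<gamma>]\<close>, whose pairwise products have finite rank, are mapped to
  pairwise orthogonal idempotents \<open>Q \<gamma>\<close>; they are non-zero because the identity of \<open>X\<close> factors
  through each band. The lower \<open>p\<close> estimate passes from \<open>X\<close> to the ranges of the \<open>Q \<gamma>\<close>, so
  \<open>\<Sum>\<gamma>\<in>A. Q \<gamma> y\<close> converges unconditionally for every set \<open>A\<close> of indices and every \<open>y\<close>. This gives
  \<open>2\<close> to the power of the continuum many operators on \<open>Y\<close>, whereas the separable space \<open>X\<close> has
  only continuum many operators, contradicting surjectivity.

  Zabreiko's lemma on countably subadditive seminorms replaces the closed graph and open
  mapping theorems throughout.
\<close>

section \<open>Zabreiko's lemma and norming functionals\<close>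

text \<open>By Baire's theorem the closure of some sublevel set of \<open>p\<close> contains a ball.
  Symmetry moves the ball to the origin, and repeated approximation expands each small vector in a
  series whose terms have geometrically decaying \<open>p\<close>; countable subadditivity then
  bounds \<open>p\<close> near the origin.\<close>

lemma zabreiko:
  fixes p :: "'a::banach \<Rightarrow> real"
  assumes nonneg: "\<And>x. 0 \<le> p x"
    and scale: "\<And>c x. p (c *\<^sub>R x) = \<bar>c\<bar> * p x"
    and triangle: "\<And>x y. p (x + y) \<le> p x + p y"
    and countable_subadditive:
      "\<And>u x. summable (\<lambda>k. p (u k)) \<Longrightarrow> u sums x \<Longrightarrow> p x \<le> (\<Sum>k. p (u k))"
  obtains K where "0 < K" "\<And>x. p x \<le> K * norm x"
proof -
  define A where "A n = closure {x. p x \<le> real n}" for n :: nat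
  have "\<exists>n. x \<in> A n" for x
  proof -
    obtain n :: nat where "p x \<le> n" using real_arch_simple by blast
    then show ?thesis
      unfolding A_def by (intro exI[of _ n] subsetD[OF closure_subset]) simp
  qed
  then have "(\<Union>n. A n) = UNIV"
    by blast
  have "\<exists>n. interior (A n) \<noteq> {}"
  proof (rule ccontr)
    assume "\<not> ?thesis"
    then have "Met_TC.mtopology interior_of \<Union>(range A) = ({} :: 'a set)"
      by (intro Met_TC.metric_Baire_category_alt)
        (auto simp: complete_UNIV interior_of_def interior_def A_def)
    then show False
      using \<open>(\<Union>n. A n) = UNIV\<close> interior_of_topspace[of "euclidean :: 'a topology"] by simp
  qed
  then obtain n x0 r where r: "r > 0" "ball x0 r \<subseteq> A n"
    by (metis all_not_in_conv mem_interior)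
  have approx: "\<exists>a. p a \<le> real n \<and> norm (y - a) < e" if "norm y < r" "e > 0" for y e
  proof -
    \<comment> \<open>If \<open>a\<close> approximates \<open>x0 + y\<close> and \<open>b\<close>
      approximates \<open>x0 - y\<close>, then \<open>(a - b) / 2\<close> approximates
      \<open>y\<close>; since \<open>p\<close> is even and subadditive, its value there is still at
      most \<open>n\<close>.\<close>
    have "x0 + y \<in> A n" "x0 - y \<in> A n"
      using that by (auto intro!: subsetD[OF r(2)] simp: dist_norm)
    then have "\<exists>a\<in>{x. p x \<le> n}. dist a (x0 + y) < e" "\<exists>b\<in>{x. p x \<le> n}. dist b (x0 - y) < e"
      using \<open>e > 0\<close> by (simp_all only: A_def closure_approachable)
    then obtain a b where a: "p a \<le> n" "norm (a - (x0 + y)) < e"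
      and b: "p b \<le> n" "norm (b - (x0 - y)) < e"
      by (auto simp only: dist_norm mem_Collect_eq)
    have "p ((1/2) *\<^sub>R a + (- (1/2)) *\<^sub>R b) \<le> 1/2 * p a + 1/2 * p b"
      by (rule order_trans[OF triangle]) (simp only: scale; simp)
    then have "p ((1/2) *\<^sub>R a + (- (1/2)) *\<^sub>R b) \<le> n"
      using a b by linarith
    moreover have "y - ((1/2) *\<^sub>R a + (- (1/2)) *\<^sub>R b)
        = (1/2) *\<^sub>R ((b - (x0 - y)) - (a - (x0 + y)))"
      by (simp add: algebra_simps flip: scaleR_add_left)
    then have "norm (y - ((1/2) *\<^sub>R a + (- (1/2)) *\<^sub>R b)) < e"
      using a b norm_triangle_ineq4[of "b - (x0 - y)" "a - (x0 + y)"] by simp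
    ultimately show ?thesis by blast
  qed
  have step: "\<exists>a. p a \<le> n / 2 ^ k \<and> norm (y - a) < r / 2 ^ Suc k"
    if y: "norm y < r / 2 ^ k" for k y
  proof -
    have "norm ((2 ^ k) *\<^sub>R y) < r"
      using y by (simp add: field_simps)
    then obtain a where a: "p a \<le> n" "norm ((2 ^ k) *\<^sub>R y - a) < r / 2"
      using approx[of "(2 ^ k) *\<^sub>R y" "r / 2"] r by auto
    have "y - (1 / 2 ^ k) *\<^sub>R a = (1 / 2 ^ k) *\<^sub>R ((2 ^ k) *\<^sub>R y - a)"
      by (simp add: algebra_simps)
    then have "norm (y - (1 / 2 ^ k) *\<^sub>R a) = (1 / 2 ^ k) * norm ((2 ^ k) *\<^sub>R y - a)"
      by (simp only: norm_scaleR) simp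
    also have "\<dots> < (1 / 2 ^ k) * (r / 2)"
      using a by (intro mult_strict_left_mono) auto
    finally have "norm (y - (1 / 2 ^ k) *\<^sub>R a) < r / 2 ^ Suc k"
      by simp
    moreover have "p ((1 / 2 ^ k) *\<^sub>R a) \<le> n / 2 ^ k"
      unfolding scale using a by (simp add: divide_right_mono)
    ultimately show ?thesis by blast
  qed
  have ball: "p x \<le> 2 * n" if x: "norm x < r" for x
  proof -
    \<comment> \<open>The \<open>y k\<close> are the successive remainders, so the differences
      \<open>y k - y (Suc k)\<close> are the approximants and they sum to \<open>x\<close>.\<close>
    have "\<exists>y. y 0 = x \<and> (\<forall>k. norm (y k) < r / 2 ^ k \<and> p (y k - y (Suc k)) \<le> n / 2 ^ k)"
    proof -
      have "\<exists>y. \<forall>k. (norm (y k) < r / 2 ^ k \<and> (k = 0 \<longrightarrow> y k = x))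
          \<and> p (y k - y (Suc k)) \<le> n / 2 ^ k"
      proof (rule dependent_nat_choice)
        show "\<exists>y. norm y < r / 2 ^ 0 \<and> (0 = (0::nat) \<longrightarrow> y = x)"
          using x by auto
        show "\<exists>z. (norm z < r / 2 ^ Suc k \<and> (Suc k = 0 \<longrightarrow> z = x)) \<and> p (y - z) \<le> n / 2 ^ k"
          if y: "norm y < r / 2 ^ k \<and> (k = 0 \<longrightarrow> y = x)" for y k
        proof -
          obtain a where "p a \<le> n / 2 ^ k" "norm (y - a) < r / 2 ^ Suc k"
            using step y by blast
          then show ?thesis by (intro exI[of _ "y - a"]) auto
        qed
      qed
      then show ?thesis by metis
    qed
    then obtain y where y: "y 0 = x" "\<And>k. norm (y k) < r / 2 ^ k"
      "\<And>k. p (y k - y (Suc k)) \<le> n / 2 ^ k"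
      by blast
    have "(\<lambda>k. r / 2 ^ k) \<longlonglongrightarrow> 0"
      by real_asymp
    then have "y \<longlonglongrightarrow> 0"
      by (rule Lim_null_comparison[rotated]) (use y in \<open>auto intro!: always_eventually less_imp_le\<close>)
    then have "(\<lambda>k. y k - y (Suc k)) sums x"
      using telescope_sums'[of y 0] y by simp
    moreover have geo: "(\<lambda>k. n / 2 ^ k) sums (2 * n)"
      using sums_mult[OF geometric_sums[of "1/2::real"], of n]
      by (simp add: power_divide mult.commute)
    moreover have summ: "summable (\<lambda>k. p (y k - y (Suc k)))"
      by (rule summable_comparison_test'[OF sums_summable[OF geo]]) (simp add: nonneg y(3))
    ultimately have "p x \<le> (\<Sum>k. p (y k - y (Suc k)))"
      by (intro countable_subadditive)
    also have "\<dots> \<le> 2 * n"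
      using suminf_le[OF y(3) summ sums_summable[OF geo]] geo by (simp add: sums_iff)
    finally show ?thesis .
  qed
  \<comment> \<open>Scaling \<open>x\<close> to norm \<open>r / 2\<close> turns the bound
    \<open>2 * n\<close> into \<open>4 * n / r\<close>; the added 1 keeps the constant positive when
    \<open>n = 0\<close>.\<close>
  have "p x \<le> (4 * n / r + 1) * norm x" for x
  proof (cases "x = 0")
    case True
    then show ?thesis using scale[of 0 0] by simp
  next
    case False
    have "norm ((r / (2 * norm x)) *\<^sub>R x) < r"
      using False r by simp
    then have "r / (2 * norm x) * p x \<le> 2 * n"
      using ball[of "(r / (2 * norm x)) *\<^sub>R x"] scale[of "r / (2 * norm x)" x] r by simp
    then have "p x \<le> 4 * n / r * norm x"
      using False r by (simp add: field_simps)
    then show ?thesis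
      by (simp add: distrib_right add_increasing2)
  qed
  moreover have "0 < 4 * n / r + 1"
    using r by (smt (verit) divide_nonneg_pos of_nat_0_le_iff)
  ultimately show thesis using that by blast
qed

text \<open>\<open>M\<close> plays the role of the graph of a partial functional dominated by the
  norm. An admissible value at \<open>z\<close> lies above every \<open>t - norm (x - z)\<close> and
  below every \<open>norm (y + z) - u\<close>. The triangle inequality separates these two families,
  so the supremum of the first one works.\<close>

lemma hahn_banach_extension_step:
  fixes M :: "('a::real_normed_vector \<times> real) set"
  assumes M: "subspace M" and le: "\<And>x t. (x, t) \<in> M \<Longrightarrow> t \<le> norm x"
  obtains c where "\<And>x t. (x, t) \<in> span (insert (z, c) M) \<Longrightarrow> t \<le> norm x"
proof -
  define l where "l = (\<lambda>(x, t). t - norm (x - z)) ` M"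
  have sep: "t - norm (x - z) \<le> norm (y + z) - u" if "(x, t) \<in> M" "(y, u) \<in> M" for x t y u
  proof -
    have "(x + y, t + u) \<in> M"
      using subspace_add[OF M that] by simp
    then show ?thesis
      using le[of "x + y" "t + u"] norm_triangle_ineq[of "x - z" "y + z"] by simp
  qed
  have zero: "(0, 0) \<in> M"
    using subspace_0[OF M] by (simp add: zero_prod_def)
  have lower: "t - norm (x - z) \<le> Sup l" if "(x, t) \<in> M" for x t
  proof (rule cSup_upper)
    show "t - norm (x - z) \<in> l" using that by (force simp: l_def)
    show "bdd_above l"
      using sep zero by (force simp: l_def intro!: bdd_aboveI[of _ "norm z"])
  qed
  have upper: "Sup l \<le> norm (y + z) - u" if "(y, u) \<in> M" for y u
    by (rule cSup_least) (use sep that zero in \<open>auto simp: l_def\<close>)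
  have "t \<le> norm x" if "(x, t) \<in> span (insert (z, Sup l) M)" for x t
  proof -
    have "\<exists>s. (x, t) - s *\<^sub>R (z, Sup l) \<in> span M"
      using that by (simp only: span_breakdown_eq)
    then obtain s where "(x, t) - s *\<^sub>R (z, Sup l) \<in> span M" ..
    then have s: "(x - s *\<^sub>R z, t - s * Sup l) \<in> M"
      using M by (simp add: span_eq_iff[THEN iffD2])
    \<comment> \<open>Division by the absolute value of \<open>s\<close> reduces to the coefficients
      1 and -1 of \<open>z\<close>, where the upper and the lower bound on \<open>Sup l\<close>
      apply respectively.\<close>
    consider "s = 0" | "s > 0" | "s < 0" by linarith
    then show ?thesis
    proof cases
      case 1
      then show ?thesis using s le by simp
    next
      case 2
      have "((1/s) *\<^sub>R (x - s *\<^sub>R z), (1/s) * (t - s * Sup l)) \<in> M"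
        using subspace_scale[OF M s, of "1/s"] by simp
      from upper[OF this] have "Sup l \<le> norm ((1/s) *\<^sub>R x) - (t / s - Sup l)"
        using 2 by (simp add: algebra_simps)
      then show ?thesis
        using 2 by (simp add: field_simps)
    next
      case 3
      have "((-1/s) *\<^sub>R (x - s *\<^sub>R z), (-1/s) * (t - s * Sup l)) \<in> M"
        using subspace_scale[OF M s, of "-1/s"] by simp
      from lower[OF this] have "(- t / s + Sup l) - norm ((-1/s) *\<^sub>R x) \<le> Sup l"
        using 3 by (simp add: algebra_simps)
      then show ?thesis
        using 3 by (simp add: field_simps)
    qed
  qed
  then show thesis using that by blast
qed

text \<open>Zorn's lemma gives a maximal dominated graph containing \<open>(x0, norm x0)\<close>,
  and the extension step forces its domain to be the whole space. It is single-valued because a pair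
  \<open>(0, t)\<close> in it makes both \<open>t\<close> and \<open>- t\<close> at most 0.\<close>

lemma exists_norming_functional:
  fixes x0 :: "'a::real_normed_vector"
  obtains f :: "'a \<Rightarrow>\<^sub>L real" where "norm f \<le> 1" "f x0 = norm x0"
proof -
  define G where "G = {M :: ('a \<times> real) set. subspace M \<and> (x0, norm x0) \<in> M \<and>
                          (\<forall>(x, t) \<in> M. t \<le> norm x)}"
  have "\<exists>M\<in>G. \<forall>X\<in>G. M \<subseteq> X \<longrightarrow> X = M"
  proof (rule subset_Zorn_nonempty)
    have "t \<le> norm x" if "(x, t) \<in> span {(x0, norm x0)}" for x t
      using that by (auto simp: span_singleton intro!: mult_right_mono)
    then have "span {(x0, norm x0)} \<in> G"
      by (auto simp: G_def span_base)
    then show "G \<noteq> {}" by blast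
  next
    fix C assume C: "C \<noteq> {}" "subset.chain G C"
    then have sub: "subspace M" if "M \<in> C" for M
      using that by (auto simp: G_def subset_chain_def)
    have "subspace (\<Union>C)"
    proof (rule subspaceI)
      show "0 \<in> \<Union>C" using C(1) sub subspace_0 by blast
      show "c *\<^sub>R v \<in> \<Union>C" if "v \<in> \<Union>C" for c v
        using that sub subspace_scale by blast
      show "v + w \<in> \<Union>C" if vw: "v \<in> \<Union>C" "w \<in> \<Union>C" for v w
      proof -
        obtain M1 M2 where M12: "M1 \<in> C" "v \<in> M1" "M2 \<in> C" "w \<in> M2"
          using vw by blast
        then have "M1 \<subseteq> M2 \<or> M2 \<subseteq> M1"
          using C(2) by (auto simp: subset_chain_def)
        then obtain M where "M \<in> C" "v \<in> M" "w \<in> M"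
          using M12 by blast
        then have "v + w \<in> M"
          by (intro subspace_add sub)
        then show ?thesis using \<open>M \<in> C\<close> by blast
      qed
    qed
    moreover have "(x0, norm x0) \<in> \<Union>C" "\<forall>(x, t) \<in> \<Union>C. t \<le> norm x"
      using C unfolding G_def subset_chain_def by blast+
    ultimately show "\<Union>C \<in> G"
      by (simp add: G_def)
  qed
  then obtain M where M: "M \<in> G" and maxM: "\<And>X. X \<in> G \<Longrightarrow> M \<subseteq> X \<Longrightarrow> X = M"
    by blast
  have subM: "subspace M" and x0M: "(x0, norm x0) \<in> M"
    and leM: "\<And>x t. (x, t) \<in> M \<Longrightarrow> t \<le> norm x"
    using M by (auto simp: G_def)
  have "\<exists>t. (x, t) \<in> M" for x
  proof -
    obtain c where c: "\<And>y t. (y, t) \<in> span (insert (x, c) M) \<Longrightarrow> t \<le> norm y"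
      using hahn_banach_extension_step[OF subM leM, where z = x] by metis
    have sub: "insert (x, c) M \<subseteq> span (insert (x, c) M)"
      by (rule span_superset)
    then have "span (insert (x, c) M) \<in> G"
      using c x0M by (auto simp: G_def)
    then have "span (insert (x, c) M) = M"
      using maxM sub by blast
    then show ?thesis using sub by blast
  qed
  then obtain f where f: "\<And>x. (x, f x) \<in> M"
    by metis
  have unique: "t = f x" if "(x, t) \<in> M" for x t
  proof -
    have "(0, t - f x) \<in> M" "(0, f x - t) \<in> M"
      using subspace_diff[OF subM that f[of x]] subspace_diff[OF subM f[of x] that] by auto
    then have "t - f x \<le> norm (0::'a)" "f x - t \<le> norm (0::'a)"
      using leM by blast+
    then show ?thesis by simp
  qed
  have add: "f (x + y) = f x + f y" for x y
    using unique[of "x + y" "f x + f y"] subspace_add[OF subM f[of x] f[of y]] by simp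
  have scale: "f (c *\<^sub>R x) = c * f x" for c x
    using unique[of "c *\<^sub>R x" "c * f x"] subspace_scale[OF subM f[of x], of c] by simp
  have "\<bar>f x\<bar> \<le> norm x" for x
    using leM[OF f[of x]] leM[OF f[of "-x"]] scale[of "-1" x] by auto
  then have bl: "bounded_linear f"
    by (intro bounded_linear_intro[where K = 1]) (auto simp: add scale)
  show thesis
  proof (rule that)
    show "norm (Blinfun f) \<le> 1"
      using \<open>\<And>x. \<bar>f x\<bar> \<le> norm x\<close> by (intro norm_blinfun_bound) (auto simp: bounded_linear_Blinfun_apply[OF bl])
    show "Blinfun f x0 = norm x0"
      using unique[OF x0M] by (simp add: bounded_linear_Blinfun_apply[OF bl])
  qed
qed

text \<open>The infimum \<open>p\<close> of the norms of preimages is countably subadditive: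
  near-optimal preimages of the terms of a series can be summed in the complete domain. Zabreiko's
  lemma then bounds \<open>p\<close> by a multiple of the norm.\<close>

lemma open_mapping_bound:
  fixes T :: "'a::banach \<Rightarrow> 'b::banach"
  assumes T: "bounded_linear T" and surj: "surj T"
  obtains M where "0 < M" "\<And>y. \<exists>x. T x = y \<and> norm x \<le> M * norm y"
proof -
  interpret T: bounded_linear T by fact
  define p where "p y = Inf (norm ` {x. T x = y})" for y
  have bdd: "bdd_below (norm ` {x. T x = y})" for y
    by (auto intro!: bdd_belowI[of _ 0])
  have ne: "norm ` {x. T x = y} \<noteq> {}" for y
    using surjD[OF surj, of y] by auto
  have lower: "p (T x) \<le> norm x" for x
    unfolding p_def by (rule cInf_lower[OF _ bdd]) auto
  have greatest: "c \<le> p y" if "\<And>x. T x = y \<Longrightarrow> c \<le> norm x" for c y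
    unfolding p_def by (rule cInf_greatest[OF ne]) (use that in auto)
  have approx: "\<exists>x. T x = y \<and> norm x < p y + e" if "e > 0" for y e
    using cInf_lessD[OF ne, of y "p y + e"] that by (auto simp: p_def)
  have nonneg: "0 \<le> p y" for y
    by (rule greatest) simp
  have scale_le: "\<bar>c\<bar> * p y \<le> p (c *\<^sub>R y)" if "c \<noteq> 0" for c y
  proof (rule greatest)
    fix x assume "T x = c *\<^sub>R y"
    then have "T ((1 / c) *\<^sub>R x) = y"
      using that by (simp add: T.scaleR)
    then have "p y \<le> norm x / \<bar>c\<bar>"
      using lower[of "(1 / c) *\<^sub>R x"] by simp
    then show "\<bar>c\<bar> * p y \<le> norm x"
      using that by (simp add: field_simps)
  qed
  have scale: "p (c *\<^sub>R y) = \<bar>c\<bar> * p y" for c y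
  proof (cases "c = 0")
    case True
    then show ?thesis
      using lower[of 0] nonneg[of 0] by (simp add: T.zero)
  next
    case False
    then have "\<bar>1 / c\<bar> * p (c *\<^sub>R y) \<le> p y"
      using scale_le[of "1 / c" "c *\<^sub>R y"] by simp
    then have "p (c *\<^sub>R y) \<le> \<bar>c\<bar> * p y"
      using False by (simp add: field_simps)
    then show ?thesis using scale_le[OF False, of y] by linarith
  qed
  have countable: "p y \<le> (\<Sum>k. p (u k))" if summ: "summable (\<lambda>k. p (u k))" and u: "u sums y" for u y
  proof (rule field_le_epsilon)
    fix e :: real assume e: "e > 0"
    \<comment> \<open>The slack \<open>e\<close> is distributed over the terms as
      \<open>e / 2 ^ Suc k\<close>, so the total excess is \<open>e\<close>.\<close>
    have geo: "(\<lambda>k. e * (1 / 2) ^ Suc k) sums e"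
      using sums_mult[OF power_half_series, of e] by simp
    have "\<exists>x. \<forall>k. T (x k) = u k \<and> norm (x k) < p (u k) + e * (1 / 2) ^ Suc k"
      by (intro choice allI approx) (use e in simp)
    then obtain x where x: "\<And>k. T (x k) = u k" "\<And>k. norm (x k) < p (u k) + e * (1 / 2) ^ Suc k"
      by blast
    have sum2: "summable (\<lambda>k. p (u k) + e * (1 / 2) ^ Suc k)"
      by (intro summable_add summ sums_summable[OF geo])
    then have sumx: "summable (\<lambda>k. norm (x k))"
      by (rule summable_comparison_test') (use x(2) in \<open>simp add: less_imp_le\<close>)
    have "T (\<Sum>k. x k) = y"
      using T.suminf[OF summable_norm_cancel[OF sumx]] u by (simp add: x(1) sums_iff)
    then have "p y \<le> norm (\<Sum>k. x k)"
      using lower by blast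
    also have "\<dots> \<le> (\<Sum>k. norm (x k))"
      by (rule summable_norm[OF sumx])
    also have "\<dots> \<le> (\<Sum>k. p (u k) + e * (1 / 2) ^ Suc k)"
      by (rule suminf_le[OF _ sumx sum2]) (use x(2) in \<open>simp add: less_imp_le\<close>)
    also have "\<dots> = (\<Sum>k. p (u k)) + e"
      using suminf_add[OF summ sums_summable[OF geo]] geo by (simp add: sums_iff)
    finally show "p y \<le> (\<Sum>k. p (u k)) + e" .
  qed
  have triangle: "p (x + y) \<le> p x + p y" for x y
  proof (rule field_le_epsilon)
    fix e :: real assume "e > 0"
    then obtain a b where "T a = x" "norm a < p x + e / 2" "T b = y" "norm b < p y + e / 2"
      using approx[of "e / 2"] by (metis half_gt_zero)
    then show "p (x + y) \<le> p x + p y + e"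
      using lower[of "a + b"] norm_triangle_ineq[of a b] by (simp add: T.add)
  qed
  obtain K where K: "0 < K" "\<And>y. p y \<le> K * norm y"
    using zabreiko[of p, OF nonneg scale triangle countable] by blast
  \<comment> \<open>The infimum need not be attained. An excess of \<open>norm y\<close> is allowed,
    hence \<open>K + 1\<close>; at \<open>y = 0\<close> this excess vanishes, so that case is
    separate.\<close>
  have "\<exists>x. T x = y \<and> norm x \<le> (K + 1) * norm y" for y
  proof (cases "y = 0")
    case True
    then show ?thesis by (intro exI[of _ 0]) (simp add: T.zero)
  next
    case False
    then obtain x where "T x = y" "norm x < p y + norm y"
      using approx[of "norm y" y] by auto
    then show ?thesis
      using K(2)[of y] by (intro exI[of _ x]) (simp add: distrib_right)
  qed
  then show thesis
    using that[of "K + 1"] K(1) by simp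
qed

section \<open>Rank-one operators and the Neumann series\<close>

definition rank_one :: "'b::real_normed_vector \<Rightarrow> ('a::real_normed_vector \<Rightarrow>\<^sub>L real) \<Rightarrow> 'a \<Rightarrow>\<^sub>L 'b"
  where "rank_one z f = blinfun_scaleR_left z o\<^sub>L f"

lemma rank_one_apply [simp]: "rank_one z f x = f x *\<^sub>R z"
  by (simp add: rank_one_def)

lemma norm_rank_one_le: "norm (rank_one z f) \<le> norm f * norm z"
proof (rule norm_blinfun_bound)
  show "norm (rank_one z f x) \<le> norm f * norm z * norm x" for x
    using mult_right_mono[OF norm_blinfun[of f x] norm_ge_zero[of z]] by (simp add: mult_ac)
qed simp

text \<open>\<open>s\<close> is the sum of the powers \<open>b ^ (n + 1)\<close>, so
  \<open>id + s\<close> inverts \<open>id - b\<close> from the left. The equation avoids the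
  identity operator, so that a linear multiplicative map can be applied to it directly.\<close>

lemma neumann_series:
  fixes b :: "'a::banach \<Rightarrow>\<^sub>L 'a"
  assumes b: "norm b < 1"
  obtains s where "s = b + (s o\<^sub>L b)"
proof -
  define w where "w n = ((\<lambda>c. c o\<^sub>L b) ^^ n) b" for n
  have w_Suc: "w (Suc n) = w n o\<^sub>L b" for n
    by (simp add: w_def)
  have "norm (w n) \<le> norm b * norm b ^ n" for n
  proof (induction n)
    case 0
    then show ?case by (simp add: w_def)
  next
    case (Suc n)
    have "norm (w (Suc n)) \<le> norm (w n) * norm b"
      unfolding w_Suc by (rule norm_blinfun_compose)
    also have "\<dots> \<le> (norm b * norm b ^ n) * norm b"
      by (intro mult_right_mono Suc.IH) simp
    finally show ?case by (simp add: mult_ac)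
  qed
  then have summ: "summable w"
    by (intro summable_comparison_test'[OF summable_mult[OF summable_geometric]]) (use b in auto)
  have "(\<Sum>n. w n) = w 0 + (\<Sum>n. w (Suc n))"
    using suminf_split_head[OF summ] by simp
  also have "(\<Sum>n. w (Suc n)) = (\<Sum>n. w n) o\<^sub>L b"
    unfolding w_Suc
    by (rule bounded_linear.suminf[OF bounded_bilinear.bounded_linear_left
          [OF bounded_bilinear_blinfun_compose] summ, symmetric])
  finally show thesis
    using that by (simp add: w_def)
qed

section \<open>Automatic continuity of surjective homomorphisms\<close>

locale surjective_algebra_hom =
  fixes h :: "('a::banach \<Rightarrow>\<^sub>L 'a) \<Rightarrow> ('b::banach \<Rightarrow>\<^sub>L 'b)"
  assumes linear_h: "linear h"
    and mult_h: "h (S o\<^sub>L T) = h S o\<^sub>L h T"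
    and surj_h: "surj h"
    and nontrivial: "\<exists>y::'b. y \<noteq> 0"
begin

sublocale h: linear h by (rule linear_h)

lemma h_id: "h id_blinfun = id_blinfun"
proof -
  obtain S where S: "h S = id_blinfun"
    using surj_h by (metis surjD)
  have "h id_blinfun = h id_blinfun o\<^sub>L h S"
    unfolding S by (rule blinfun_eqI) simp
  also have "\<dots> = h S"
    unfolding mult_h[symmetric] by (rule arg_cong[of _ _ h], rule blinfun_eqI) simp
  finally show ?thesis using S by simp
qed

text \<open>If \<open>\<bar>t\<bar> > norm a\<close>, the Neumann series of \<open>a / t\<close> would give a left inverse of
  \<open>id - rank_one z f\<close>, which kills \<open>z\<close>.\<close>

lemma abs_le_norm_preimage:
  assumes a: "h a = t *\<^sub>R rank_one z f" and f: "f z = 1"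
  shows "\<bar>t\<bar> \<le> norm a"
proof (rule ccontr)
  assume less: "\<not> \<bar>t\<bar> \<le> norm a"
  then have "t \<noteq> 0" using norm_ge_zero[of a] by auto
  define b where "b = (1 / t) *\<^sub>R a"
  have "norm b < 1"
    using less \<open>t \<noteq> 0\<close> by (simp add: b_def field_simps)
  then obtain s where s: "s = b + (s o\<^sub>L b)"
    by (rule neumann_series)
  have "h b = rank_one z f"
    using \<open>t \<noteq> 0\<close> by (simp add: b_def h.scale a)
  then have "h s = rank_one z f + (h s o\<^sub>L rank_one z f)"
    using arg_cong[OF s, of h] by (simp add: h.add mult_h)
  from arg_cong[OF this, of "\<lambda>u. blinfun_apply u z"] have "z = 0"
    using f by (simp add: blinfun.add_left)
  then show False using f by simp
qed

lemma exists_dual_pair: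
  obtains z :: 'b and f :: "'b \<Rightarrow>\<^sub>L real" where "f z = 1"
proof -
  obtain y :: 'b where "y \<noteq> 0" using nontrivial by blast
  moreover obtain f :: "'b \<Rightarrow>\<^sub>L real" where "f y = norm y"
    by (metis exists_norming_functional)
  ultimately show thesis
    by (intro that[of f "(1 / norm y) *\<^sub>R y"]) (simp add: blinfun.scaleR_right)
qed

text \<open>Composing \<open>h a\<close> on both sides with rank-one operators leaves the scalar
  \<open>f (h a z)\<close> times the idempotent \<open>rank_one z0 f0\<close>. Lifting the outer
  factors to \<open>c2\<close> and \<open>c1\<close> exhibits this as the image of a product
  containing \<open>a\<close>, and \<open>abs_le_norm_preimage\<close> bounds the scalar.\<close>

lemma weakly_bounded:
  fixes f :: "'b \<Rightarrow>\<^sub>L real"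
  obtains K where "\<And>a. \<bar>f (h a z)\<bar> \<le> K * norm a"
proof -
  obtain z0 :: 'b and f0 :: "'b \<Rightarrow>\<^sub>L real" where f0: "f0 z0 = 1"
    by (rule exists_dual_pair)
  obtain c1 c2 where c1: "h c1 = rank_one z f0" and c2: "h c2 = rank_one z0 f"
    using surj_h by (metis surjD)
  have "\<bar>f (h a z)\<bar> \<le> norm c2 * norm c1 * norm a" for a
  proof -
    have "h (c2 o\<^sub>L (a o\<^sub>L c1)) = f (h a z) *\<^sub>R rank_one z0 f0"
      by (rule blinfun_eqI)
        (simp add: mult_h c1 c2 blinfun.scaleR_left blinfun.scaleR_right mult_ac)
    then have "\<bar>f (h a z)\<bar> \<le> norm (c2 o\<^sub>L (a o\<^sub>L c1))"
      using f0 by (rule abs_le_norm_preimage)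
    also have "\<dots> \<le> norm c2 * norm (a o\<^sub>L c1)"
      by (rule norm_blinfun_compose)
    also have "\<dots> \<le> norm c2 * (norm a * norm c1)"
      by (intro mult_left_mono norm_blinfun_compose) simp
    finally show ?thesis by (simp add: mult_ac)
  qed
  then show thesis by (rule that)
qed

text \<open>Zabreiko's lemma is applied to \<open>norm (h a)\<close>. Its countable subadditivity
  follows once \<open>h a\<close> is the sum of the \<open>h (u k)\<close>; the maps taking
  \<open>a\<close> to \<open>f (h a z)\<close>, continuous by \<open>weakly_bounded\<close>, detect
  any difference.\<close>

lemma bounded_linear_h: "bounded_linear h"
proof -
  have "norm (h a) \<le> (\<Sum>k. norm (h (u k)))"
    if summ: "summable (\<lambda>k. norm (h (u k)))" and u: "u sums a" for u a
  proof -
    have "h a z = (\<Sum>k. h (u k)) z" for z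
    proof -
      obtain f :: "'b \<Rightarrow>\<^sub>L real" where
        f: "f (h a z - (\<Sum>k. h (u k)) z) = norm (h a z - (\<Sum>k. h (u k)) z)"
        by (metis exists_norming_functional)
      obtain K where K: "\<And>a. \<bar>f (h a z)\<bar> \<le> K * norm a"
        using weakly_bounded by blast
      have "bounded_linear (\<lambda>a. f (h a z))"
        by (rule bounded_linear_intro[where K = K])
          (use K in \<open>simp_all add: h.add h.scale blinfun.bilinear_simps mult.commute\<close>)
      from bounded_linear.sums[OF this u] have 1: "(\<lambda>k. f (h (u k) z)) sums f (h a z)" .
      have "bounded_linear (\<lambda>S :: 'b \<Rightarrow>\<^sub>L 'b. f (S z))"
        by (intro bounded_linear_compose[OF blinfun.bounded_linear_right] blinfun.bounded_linear_left)
      from bounded_linear.sums[OF this summable_sums[OF summable_norm_cancel[OF summ]]]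
      have 2: "(\<lambda>k. f (h (u k) z)) sums f ((\<Sum>k. h (u k)) z)" .
      have "f (h a z) = f ((\<Sum>k. h (u k)) z)"
        by (rule sums_unique2[OF 1 2])
      then show ?thesis
        using f by (simp add: blinfun.diff_right)
    qed
    then have "h a = (\<Sum>k. h (u k))" by (rule blinfun_eqI)
    then show ?thesis using summable_norm[OF summ] by simp
  qed
  then obtain K where K: "\<And>a. norm (h a) \<le> K * norm a"
    by (rule zabreiko[of "\<lambda>a. norm (h a)", rotated 3])
      (simp_all add: h.scale h.add norm_triangle_ineq, blast)
  show ?thesis
    by (rule bounded_linear_intro[where K = K]) (use K in \<open>simp_all add: h.add h.scale mult.commute\<close>)
qed

end

section \<open>Band projections of an unconditional decomposition\<close>

locale unconditional_decomposition =
  fixes X :: "nat \<Rightarrow> 'a::banach set"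
  assumes unconditional: "unconditional_schauder_decomposition X"
begin

abbreviation proj :: "nat \<Rightarrow> 'a \<Rightarrow> 'a"
  where "proj \<equiv> decomposition_proj X"

lemma subspace_component: "subspace (X n)"
  and closed_component: "closed (X n)"
  and ex1_expansion: "\<exists>!u. (\<forall>n. u n \<in> X n) \<and> u sums x"
  using unconditional
  unfolding unconditional_schauder_decomposition_def schauder_decomposition_def by blast+

lemma proj_in: "proj n x \<in> X n"
  and proj_sums: "(\<lambda>n. proj n x) sums x"
  using theI'[OF ex1_expansion[of x]] by (auto simp: decomposition_proj_def)

lemma proj_unique:
  assumes "\<And>n. v n \<in> X n" "v sums x"
  shows "proj n x = v n"
  using ex1_expansion[of x] assms proj_in proj_sums by metis

lemma proj_add: "proj n (x + y) = proj n x + proj n y"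
  by (rule proj_unique) (auto intro: subspace_add subspace_component proj_in sums_add proj_sums)

lemma proj_scaleR: "proj n (c *\<^sub>R x) = c *\<^sub>R proj n x"
  by (rule proj_unique) (auto intro: subspace_scale subspace_component proj_in sums_scaleR_right proj_sums)

sublocale proj: linear "proj n"
  by (rule linearI) (auto simp: proj_add proj_scaleR)

lemma proj_eqI: "(\<And>n. proj n x = proj n y) \<Longrightarrow> x = y"
  using proj_sums[of x] proj_sums[of y] sums_unique2 by simp

lemma proj_has_sum: "((\<lambda>n. proj n x) has_sum x) UNIV"
proof -
  have "\<forall>x u. (\<forall>n. u n \<in> X n) \<and> u sums x \<longrightarrow> (u has_sum x) UNIV"
    using unconditional by (simp add: unconditional_schauder_decomposition_def)
  from this[rule_format, of "\<lambda>n. proj n x" x] show ?thesis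
    using proj_in proj_sums by simp
qed

lemma proj_summable_on: "(\<lambda>n. proj n x) summable_on A"
  using proj_has_sum summable_on_subset_banach[of _ UNIV] by (metis has_sum_imp_summable subset_UNIV)

text \<open>A finite set containing \<open>F0\<close> has its sum within 1 of \<open>x\<close>. An
  arbitrary \<open>F\<close> differs from its union with \<open>F0\<close> only by part of
  \<open>F0\<close>, which contributes a bounded amount.\<close>

lemma finite_sums_bounded: "\<exists>c. \<forall>F. finite F \<longrightarrow> norm (\<Sum>n\<in>F. proj n x) \<le> c"
proof -
  have "\<forall>\<^sub>F F in finite_subsets_at_top UNIV. dist (\<Sum>n\<in>F. proj n x) x < 1"
    using proj_has_sum[of x] unfolding has_sum_def tendsto_iff by (metis zero_less_one)
  then obtain F0 where "finite F0"
    and F0: "\<And>F. finite F \<Longrightarrow> F0 \<subseteq> F \<Longrightarrow> dist (\<Sum>n\<in>F. proj n x) x < 1"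
    unfolding eventually_finite_subsets_at_top by (metis subset_UNIV)
  have "norm (\<Sum>n\<in>F. proj n x) \<le> norm x + 1 + (\<Sum>n\<in>F0. norm (proj n x))" if "finite F" for F
  proof -
    have "(\<Sum>n\<in>F \<union> F0. proj n x) = (\<Sum>n\<in>F. proj n x) + (\<Sum>n\<in>F0 - F. proj n x)"
      using that \<open>finite F0\<close> by (subst sum.union_disjoint[symmetric]) auto
    moreover have "norm (\<Sum>n\<in>F \<union> F0. proj n x) \<le> norm x + 1"
      using F0[of "F \<union> F0"] that \<open>finite F0\<close>
        norm_triangle_ineq2[of "\<Sum>n\<in>F \<union> F0. proj n x" x] by (simp add: dist_norm)
    moreover have "norm (\<Sum>n\<in>F0 - F. proj n x) \<le> (\<Sum>n\<in>F0 - F. norm (proj n x))"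
      by (rule norm_sum)
    moreover have "\<dots> \<le> (\<Sum>n\<in>F0. norm (proj n x))"
      by (rule sum_mono2) (use \<open>finite F0\<close> in auto)
    ultimately show ?thesis
      using norm_triangle_ineq4[of "\<Sum>n\<in>F \<union> F0. proj n x" "\<Sum>n\<in>F0 - F. proj n x"] by simp
  qed
  then show ?thesis by blast
qed

text \<open>Zabreiko's lemma is applied to the supremum \<open>p\<close> of the norms of finite
  partial sums. Its countable subadditivity rests on uniqueness of expansions: summing coordinates
  termwise gives an expansion of the limit, hence the expansion. Continuity of the coordinates is
  thus a consequence.\<close>

lemma finite_sums_uniformly_bounded:
  obtains K where "0 < K" "\<And>F x. finite F \<Longrightarrow> norm (\<Sum>n\<in>F. proj n x) \<le> K * norm x"
proof -
  define p where "p x = (SUP F\<in>{F. finite F}. norm (\<Sum>n\<in>F. proj n x))" for x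
  have bdd: "bdd_above ((\<lambda>F. norm (\<Sum>n\<in>F. proj n x)) ` {F. finite F})" for x
    using finite_sums_bounded[of x] by (auto simp: bdd_above_def)
  have upper: "norm (\<Sum>n\<in>F. proj n x) \<le> p x" if "finite F" for F x
    unfolding p_def by (rule cSUP_upper[OF _ bdd]) (use that in simp)
  have least: "p x \<le> c" if "\<And>F. finite F \<Longrightarrow> norm (\<Sum>n\<in>F. proj n x) \<le> c" for c x
    unfolding p_def by (rule cSUP_least) (use that in auto)
  have nonneg: "0 \<le> p x" for x
    using upper[of "{}" x] by simp
  have scale_le: "p (c *\<^sub>R x) \<le> \<bar>c\<bar> * p x" for c x
  proof (rule least)
    fix F :: "nat set" assume "finite F"
    then show "norm (\<Sum>n\<in>F. proj n (c *\<^sub>R x)) \<le> \<bar>c\<bar> * p x"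
      using mult_left_mono[OF upper[of F x] abs_ge_zero[of c]]
      by (simp add: proj_scaleR flip: scaleR_sum_right)
  qed
  have scale: "p (c *\<^sub>R x) = \<bar>c\<bar> * p x" for c x
  proof (cases "c = 0")
    case True
    then show ?thesis using scale_le[of 0 x] nonneg[of 0] by simp
  next
    case False
    have "p x \<le> \<bar>1 / c\<bar> * p (c *\<^sub>R x)"
      using scale_le[of "1 / c" "c *\<^sub>R x"] False by simp
    then have "\<bar>c\<bar> * p x \<le> p (c *\<^sub>R x)"
      using False by (simp add: field_simps)
    then show ?thesis using scale_le[of c x] by simp
  qed
  have triangle: "p (x + y) \<le> p x + p y" for x y
  proof (rule least)
    fix F :: "nat set" assume "finite F"
    then show "norm (\<Sum>n\<in>F. proj n (x + y)) \<le> p x + p y"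
      using upper[of F x] upper[of F y]
        norm_triangle_ineq[of "\<Sum>n\<in>F. proj n x" "\<Sum>n\<in>F. proj n y"]
      by (simp add: proj_add sum.distrib)
  qed
  have norm_le: "norm x \<le> p x" for x
    by (rule Lim_norm_ubound[OF sequentially_bot proj_sums[of x, unfolded sums_def]])
      (simp add: upper)
  have countable: "p x \<le> (\<Sum>k. p (u k))" if summ: "summable (\<lambda>k. p (u k))" and u: "u sums x" for u x
  proof -
    have summ_F: "summable (\<lambda>k. \<Sum>n\<in>F. proj n (u k))" if "finite F" for F
      by (rule summable_norm_cancel, rule summable_comparison_test'[OF summ])
        (simp add: upper that)
    have summ_n: "summable (\<lambda>k. proj n (u k))" for n
      using summ_F[of "{n}"] by simp
    define v where "v n = (\<Sum>k. proj n (u k))" for n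
    have sum_v: "(\<Sum>n\<in>F. v n) = (\<Sum>k. \<Sum>n\<in>F. proj n (u k))" for F
      unfolding v_def by (rule suminf_sum[symmetric]) (rule summ_n)
    have v_in: "v n \<in> X n" for n
    proof (rule closed_sequentially[OF closed_component])
      show "(\<lambda>N. \<Sum>k<N. proj n (u k)) \<longlonglongrightarrow> v n"
        unfolding v_def by (rule summable_LIMSEQ[OF summ_n])
      show "(\<Sum>k<N. proj n (u k)) \<in> X n" for N
        by (intro subspace_sum[OF subspace_component] proj_in)
    qed
    have v_sums: "v sums x"
    proof -
      \<comment> \<open>Tannery's theorem exchanges the limits: for fixed \<open>k\<close> the
        remainder tends to 0 as \<open>N\<close> grows, and it is dominated by the summable
        \<open>2 * p (u k)\<close>.\<close>
      let ?d = "\<lambda>k N. norm (u k - (\<Sum>n<N. proj n (u k)))"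
      have lim: "?d k \<longlonglongrightarrow> 0" for k
        using tendsto_norm[OF tendsto_diff[OF tendsto_const[of "u k"] proj_sums[of "u k", unfolded sums_def]]]
        by simp
      have bound: "?d k N \<le> 2 * p (u k)" for k N
        using norm_triangle_ineq4[of "u k" "\<Sum>n<N. proj n (u k)"] norm_le[of "u k"]
          upper[of "{..<N}" "u k"] by simp
      have summ2: "summable (\<lambda>k. 2 * p (u k))"
        by (intro summable_mult summ)
      have "\<forall>\<^sub>F (k, N) in sequentially \<times>\<^sub>F sequentially. norm (?d k N) \<le> 2 * p (u k)"
        by (intro always_eventually) (auto simp: bound)
      from tannerys_theorem[OF lim this summ2]
      have tannery: "(\<lambda>N. \<Sum>k. ?d k N) \<longlonglongrightarrow> 0"
        by simp
      have le: "norm (x - (\<Sum>n<N. v n)) \<le> (\<Sum>k. ?d k N)" for N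
      proof -
        have "(\<lambda>k. u k - (\<Sum>n<N. proj n (u k))) sums (x - (\<Sum>n<N. v n))"
          unfolding sum_v by (rule sums_diff[OF u summable_sums[OF summ_F]]) simp
        then have "x - (\<Sum>n<N. v n) = (\<Sum>k. u k - (\<Sum>n<N. proj n (u k)))"
          by (rule sums_unique)
        also have "norm \<dots> \<le> (\<Sum>k. ?d k N)"
          by (rule summable_norm, rule summable_comparison_test'[OF summ2]) (simp add: bound)
        finally show ?thesis .
      qed
      have "(\<lambda>N. x - (\<Sum>n<N. v n)) \<longlonglongrightarrow> 0"
        by (rule Lim_null_comparison[OF always_eventually[OF allI[OF le]] tannery])
      from tendsto_diff[OF tendsto_const[of x] this] show ?thesis
        by (simp add: sums_def)
    qed
    show ?thesis
    proof (rule least)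
      fix F :: "nat set" assume F: "finite F"
      have summ': "summable (\<lambda>k. norm (\<Sum>n\<in>F. proj n (u k)))"
        by (rule summable_comparison_test'[OF summ]) (simp add: upper F)
      have "(\<Sum>n\<in>F. proj n x) = (\<Sum>k. \<Sum>n\<in>F. proj n (u k))"
        using proj_unique[OF v_in v_sums] sum_v by simp
      also have "norm \<dots> \<le> (\<Sum>k. norm (\<Sum>n\<in>F. proj n (u k)))"
        by (rule summable_norm[OF summ'])
      also have "\<dots> \<le> (\<Sum>k. p (u k))"
        by (rule suminf_le[OF _ summ' summ]) (simp add: upper F)
      finally show "norm (\<Sum>n\<in>F. proj n x) \<le> (\<Sum>k. p (u k))" .
    qed
  qed
  obtain K where K: "0 < K" "\<And>x. p x \<le> K * norm x"
    using zabreiko[of p, OF nonneg scale triangle countable] by blast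
  show thesis
    by (rule that[OF K(1) order_trans[OF upper K(2)]])
qed

definition band_proj :: "nat set \<Rightarrow> 'a \<Rightarrow>\<^sub>L 'a"
  where "band_proj A = Blinfun (\<lambda>x. \<Sum>\<^sub>\<infinity>n\<in>A. proj n x)"

lemma norm_infsum_proj_le:
  obtains K where "0 < K" "\<And>A x. norm (\<Sum>\<^sub>\<infinity>n\<in>A. proj n x) \<le> K * norm x"
proof -
  obtain K where K: "0 < K" "\<And>F x. finite F \<Longrightarrow> norm (\<Sum>n\<in>F. proj n x) \<le> K * norm x"
    by (rule finite_sums_uniformly_bounded) blast
  have "norm (\<Sum>\<^sub>\<infinity>n\<in>A. proj n x) \<le> K * norm x" for A x
    by (rule Lim_norm_ubound[OF _ infsum_tendsto[OF proj_summable_on]])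
      (auto simp: K eventually_finite_subsets_at_top)
  then show thesis using K(1) that by blast
qed

lemma band_proj_apply: "band_proj A x = (\<Sum>\<^sub>\<infinity>n\<in>A. proj n x)"
proof -
  obtain K where K: "0 < K" "\<And>A x. norm (\<Sum>\<^sub>\<infinity>n\<in>A. proj n x) \<le> K * norm x"
    by (rule norm_infsum_proj_le) blast
  have "bounded_linear (\<lambda>x. \<Sum>\<^sub>\<infinity>n\<in>A. proj n x)"
    by (rule bounded_linear_intro[where K = K])
      (use K in \<open>simp_all add: proj_add proj_scaleR infsum_add infsum_scaleR_right
         proj_summable_on mult.commute\<close>)
  then show ?thesis
    by (simp add: band_proj_def bounded_linear_Blinfun_apply)
qed

lemma norm_band_proj_le:
  obtains K where "0 < K" "\<And>A. norm (band_proj A) \<le> K"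
proof -
  obtain K where K: "0 < K" "\<And>A x. norm (\<Sum>\<^sub>\<infinity>n\<in>A. proj n x) \<le> K * norm x"
    by (rule norm_infsum_proj_le) blast
  then have "norm (band_proj A) \<le> K" for A
    by (intro norm_blinfun_bound) (auto simp: band_proj_apply)
  then show thesis using K(1) that by blast
qed

text \<open>Coordinates determine a vector by \<open>proj_eqI\<close>, so this formula reduces the
  algebra of band projections to that of index sets.\<close>

lemma proj_band_proj: "proj n (band_proj A x) = (if n \<in> A then proj n x else 0)"
proof (rule proj_unique)
  show "(if n \<in> A then proj n x else 0) \<in> X n" for n
    using proj_in subspace_0[OF subspace_component] by simp
  have "((\<lambda>n. proj n x) has_sum band_proj A x) A"
    unfolding band_proj_apply by (rule has_sum_infsum[OF proj_summable_on])
  then have "((\<lambda>n. if n \<in> A then proj n x else 0) has_sum band_proj A x) UNIV"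
    by (rule iffD1[OF has_sum_cong_neutral, rotated -1]) auto
  then show "(\<lambda>n. if n \<in> A then proj n x else 0) sums band_proj A x"
    by (rule has_sum_imp_sums)
qed

lemma band_proj_compose: "band_proj A o\<^sub>L band_proj B = band_proj (A \<inter> B)"
  by (rule blinfun_eqI, rule proj_eqI) (simp add: proj_band_proj)

lemma band_proj_Un: "A \<inter> B = {} \<Longrightarrow> band_proj (A \<union> B) = band_proj A + band_proj B"
  by (rule blinfun_eqI, rule proj_eqI) (auto simp: proj_band_proj blinfun.add_left proj_add)

lemma band_proj_empty [simp]: "band_proj {} = 0"
  by (rule blinfun_eqI, rule proj_eqI) (simp add: proj_band_proj proj.zero)

lemma band_proj_UN:
  assumes "finite I" "\<And>i j. i \<in> I \<Longrightarrow> j \<in> I \<Longrightarrow> i \<noteq> j \<Longrightarrow> A i \<inter> A j = {}"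
  shows "band_proj (\<Union>i\<in>I. A i) = (\<Sum>i\<in>I. band_proj (A i))"
  using assms
proof (induction I)
  case (insert i I)
  have "A i \<inter> A j = {}" if "j \<in> I" for j
    using insert.hyps that by (intro insert.prems) auto
  then have disj: "A i \<inter> (\<Union>j\<in>I. A j) = {}" by blast
  have "band_proj (\<Union>j\<in>I. A j) = (\<Sum>j\<in>I. band_proj (A j))"
    by (rule insert.IH) (use insert.prems in simp)
  then show ?case
    using insert.hyps by (simp add: band_proj_Un[OF disj])
qed simp

text \<open>The fixed vectors of \<open>band_proj A\<close> form a closed subspace containing
  \<open>X n\<close> for every \<open>n\<close> in \<open>A\<close>. With
  \<open>band_proj_in_closed_span\<close> this identifies its range with the closed span occurring
  in \<open>property_sharp'\<close>.\<close>

lemma band_proj_closed_span: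
  assumes "x \<in> closed_span (\<Union>n\<in>A. X n)"
  shows "band_proj A x = x"
proof -
  define Z where "Z = {x. band_proj A x = x}"
  have "closed Z"
    unfolding Z_def by (rule closed_Collect_eq[OF blinfun.continuous_on[OF continuous_on_const continuous_on_id] continuous_on_id])
  moreover have "subspace Z"
    by (simp add: Z_def subspace_def blinfun.add_right blinfun.scaleR_right)
  moreover have "(\<Union>n\<in>A. X n) \<subseteq> Z"
  proof clarify
    fix n x assume n: "n \<in> A" "x \<in> X n"
    have single: "proj m x = (if m = n then x else 0)" for m
      by (rule proj_unique) (use n subspace_0[OF subspace_component] sums_single[of n "\<lambda>_. x"] in auto)
    have "band_proj A x = x"
      by (rule proj_eqI) (simp add: proj_band_proj single n(1))
    then show "x \<in> Z"
      by (simp add: Z_def)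
  qed
  ultimately have "closed_span (\<Union>n\<in>A. X n) \<subseteq> Z"
    unfolding closed_span_def by (intro closure_minimal span_minimal)
  then show ?thesis using assms by (auto simp: Z_def)
qed

lemma band_proj_in_closed_span: "band_proj A x \<in> closed_span (\<Union>n\<in>A. X n)"
proof -
  have "((\<lambda>F. \<Sum>n\<in>F. proj n x) \<longlongrightarrow> band_proj A x) (finite_subsets_at_top A)"
    unfolding band_proj_apply by (rule infsum_tendsto[OF proj_summable_on])
  moreover have "\<forall>\<^sub>F F in finite_subsets_at_top A. (\<Sum>n\<in>F. proj n x) \<in> closed_span (\<Union>n\<in>A. X n)"
  proof -
    have "(\<Sum>n\<in>F. proj n x) \<in> closed_span (\<Union>n\<in>A. X n)" if "F \<subseteq> A" for F
      unfolding closed_span_def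
      by (intro subsetD[OF closure_subset] span_sum span_base) (use that proj_in in blast)
    then show ?thesis
      by (auto simp: eventually_finite_subsets_at_top)
  qed
  ultimately show ?thesis
    by (intro Lim_in_closed_set[of "closed_span (\<Union>n\<in>A. X n)"]) (auto simp: closed_span_def)
qed

end

section \<open>Counting the operators on \<open>X\<close>\<close>

lemma inj_real_functions_to_real:
  "\<exists>\<phi> :: ('i::countable \<Rightarrow> real) \<Rightarrow> real. inj \<phi>"
proof -
  \<comment> \<open>A real number is determined by the rationals below it, so \<open>g\<close> is
    coded by a subset of a countable set.\<close>
  define \<psi> where "\<psi> g = to_nat ` {(i :: 'i, q :: rat). of_rat q < g i}" for g :: "'i \<Rightarrow> real"
  have "inj \<psi>"
  proof (rule injI, rule ext)
    fix g g' i assume "\<psi> g = \<psi> g'"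
    then have "{(i :: 'i, q :: rat). of_rat q < g i} = {(i, q). of_rat q < g' i}"
      unfolding \<psi>_def by (simp add: inj_image_eq_iff)
    then have rat: "of_rat q < g i \<longleftrightarrow> of_rat q < g' i" for q
      by blast
    show "g i = g' i"
    proof (rule ccontr)
      assume "g i \<noteq> g' i"
      then consider "g i < g' i" | "g' i < g i" by linarith
      then show False
        by cases (metis of_rat_dense rat less_asym)+
    qed
  qed
  moreover obtain \<theta> :: "nat set \<Rightarrow> real" where "inj \<theta>"
    using nat_sets_eqpoll_reals by (meson bij_betw_def eqpoll_def)
  ultimately show ?thesis
    by (metis inj_compose)
qed

locale unconditional_fdd = unconditional_decomposition +
  assumes finite_dimensional: "\<exists>B. finite B \<and> X n = span B"
begin

text \<open>By continuity an operator is determined by its values on countably many spanning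
  vectors, and each value by countably many real coefficients.\<close>

lemma inj_operators_to_real: "\<exists>\<phi> :: ('a \<Rightarrow>\<^sub>L 'a) \<Rightarrow> real. inj \<phi>"
proof -
  obtain B where fin: "\<And>n. finite (B n)" and B: "\<And>n. X n = span (B n)"
    using finite_dimensional by metis
  \<comment> \<open>Every spanning set is enumerated by all of \<open>nat\<close>; inserting 0 keeps
    the set non-empty when \<open>B n\<close> is empty.\<close>
  define e where "e n j = from_nat_into (insert 0 (B n)) j" for n j
  have e_surj: "\<exists>j. b = e n j" if "b \<in> B n" for n b
    unfolding e_def using from_nat_into_surj[of "insert 0 (B n)" b] fin that
    by (metis countable_finite finite_insert insertCI)
  \<comment> \<open>The spanning vectors may be dependent, so the coefficients are merely chosen and
    may fail to be linear in \<open>x\<close>; they still determine \<open>proj n x\<close>.\<close>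
  have "\<exists>c. proj n x = (\<Sum>b\<in>B n. c b *\<^sub>R b)" for n x
    using proj_in[of n x] unfolding B span_finite[OF fin] by blast
  then obtain c where c: "\<And>n x. proj n x = (\<Sum>b\<in>B n. c n x b *\<^sub>R b)"
    by metis
  have coordinates: "x = y" if eq: "\<And>n j. c n x (e n j) = c n y (e n j)" for x y
  proof (rule proj_eqI)
    fix n
    have "c n x b = c n y b" if "b \<in> B n" for b
      using e_surj[OF that] eq by blast
    then show "proj n x = proj n y"
      by (simp add: c)
  qed
  have determined: "S = T" if eq: "\<And>n j. S (e n j) = T (e n j)" for S T :: "'a \<Rightarrow>\<^sub>L 'a"
  proof (rule blinfun_eqI)
    fix x
    have "S y = T y" if "y \<in> X n" for n y
    proof (rule linear_eq_on_span[of S T "B n"])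
      show "y \<in> span (B n)" using that B by blast
      show "S b = T b" if "b \<in> B n" for b
        using e_surj[OF that] eq by blast
    qed (simp_all add: blinfun.bounded_linear_right bounded_linear.linear)
    then have "S (proj n x) = T (proj n x)" for n
      using proj_in by blast
    moreover have "(\<lambda>n. R (proj n x)) sums R x" for R :: "'a \<Rightarrow>\<^sub>L 'a"
      by (rule bounded_linear.sums[OF blinfun.bounded_linear_right proj_sums])
    ultimately show "S x = T x"
      by (metis (no_types, lifting) sums_cong sums_unique2)
  qed
  define \<psi> where "\<psi> T = (\<lambda>(n, j, m, i). c n (blinfun_apply T (e m i)) (e n j))" for T :: "'a \<Rightarrow>\<^sub>L 'a"
  have "inj \<psi>"
  proof (rule injI, rule determined, rule coordinates)
    fix S T n j m i assume "\<psi> S = \<psi> T"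
    then have "\<psi> S (n, j, m, i) = \<psi> T (n, j, m, i)" by simp
    then show "c n (S (e m i)) (e n j) = c n (T (e m i)) (e n j)"
      by (simp add: \<psi>_def)
  qed
  then show ?thesis
    using inj_real_functions_to_real by (metis inj_compose)
qed

end

section \<open>Auxiliary facts on continuity and summability\<close>

lemma linear_continuous_imp_bounded_linear:
  fixes f :: "'a::real_normed_vector \<Rightarrow> 'b::real_normed_vector"
  assumes f: "linear f" and cont: "continuous_on UNIV f"
  shows "bounded_linear f"
proof -
  interpret linear f by fact
  obtain d where d: "d > 0" "\<And>x. norm x < d \<Longrightarrow> norm (f x) < 1"
    using cont[unfolded continuous_on_iff, rule_format, of 0 1] by (auto simp: zero)
  have "norm (f x) \<le> norm x * (2 / d)" for x
  proof (cases "x = 0")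
    case True
    then show ?thesis by (simp add: zero)
  next
    case False
    have "norm (f ((d / (2 * norm x)) *\<^sub>R x)) < 1"
      by (rule d(2)) (use False d in simp)
    then have "d / (2 * norm x) * norm (f x) < 1"
      using d(1) by (simp add: scale)
    then show ?thesis using False d(1) by (simp add: field_simps)
  qed
  then show ?thesis
    by (intro bounded_linear_intro[where K = "2 / d"]) (simp_all add: add scale)
qed

text \<open>When the Cauchy criterion fails, some \<open>e\<close> admits a finite block of norm at
  least \<open>e\<close> outside every finite index set. Choosing each block outside all earlier
  ones makes them disjoint.\<close>

lemma not_summable_on_imp_blocks:
  fixes f :: "'i \<Rightarrow> 'b::banach"
  assumes "\<not> f summable_on UNIV"
  obtains e G where "0 < e" "\<And>n::nat. finite (G n)" "\<And>n. e \<le> norm (\<Sum>i\<in>G n. f i)"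
    "\<And>m n. m \<noteq> n \<Longrightarrow> G m \<inter> G n = {}"
proof -
  have "\<exists>e>0. \<forall>F. finite F \<longrightarrow> (\<exists>G. finite G \<and> G \<inter> F = {} \<and> e \<le> norm (\<Sum>i\<in>G. f i))"
  proof (rule ccontr)
    assume "\<not> ?thesis"
    then have "\<forall>e>0. \<exists>F. finite F \<and> (\<forall>G. finite G \<longrightarrow> G \<inter> F = {} \<longrightarrow> norm (\<Sum>i\<in>G. f i) < e)"
      by (meson not_le)
    then have "\<exists>F. \<forall>n. finite (F n) \<and>
        (\<forall>G. finite G \<longrightarrow> G \<inter> F n = {} \<longrightarrow> norm (\<Sum>i\<in>G. f i) < inverse (real (Suc n)))"
      by (intro choice allI) simp
    then obtain F where fin: "\<And>n. finite (F n)"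
      and small: "\<And>n G. finite G \<Longrightarrow> G \<inter> F n = {} \<Longrightarrow> norm (\<Sum>i\<in>G. f i) < inverse (real (Suc n))"
      by blast
    \<comment> \<open>The unions make the exceptional sets increasing, so the sums
      \<open>s n\<close> form a Cauchy sequence.\<close>
    define U where "U n = (\<Union>k\<le>n. F k)" for n
    define s where "s n = (\<Sum>i\<in>U n. f i)" for n
    have finU: "finite (U n)" for n
      by (simp add: U_def fin)
    have close: "norm ((\<Sum>i\<in>G. f i) - s n) < inverse (real (Suc n))" if "finite G" "U n \<subseteq> G" for G n
    proof -
      have "(\<Sum>i\<in>G. f i) - s n = (\<Sum>i\<in>G - U n. f i)"
        unfolding s_def using that by (simp add: sum_diff)
      moreover have "(G - U n) \<inter> F n = {}"
        by (auto simp: U_def)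
      ultimately show ?thesis
        using small[of "G - U n" n] that(1) by simp
    qed
    have "U n \<subseteq> U m" if "n \<le> m" for n m
      using that by (force simp: U_def)
    then have step: "norm (s m - s n) < inverse (real (Suc n))" if "n \<le> m" for n m
      using close[OF finU[of m], of n] that by (simp add: s_def)
    have "Cauchy s"
    proof (rule CauchyI')
      fix e :: real assume "0 < e"
      then obtain N where N: "inverse (real (Suc N)) < e"
        using reals_Archimedean by blast
      have "dist (s m) (s n) < e" if "N \<le> m" "m < n" for m n
      proof -
        have "norm (s n - s m) < inverse (real (Suc m))"
          using step that by simp
        also have "\<dots> \<le> inverse (real (Suc N))"
          using that by simp
        finally show ?thesis using N by (simp add: dist_norm norm_minus_commute)
      qed
      then show "\<exists>M. \<forall>m\<ge>M. \<forall>n>m. dist (s m) (s n) < e" by blast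
    qed
    then obtain l where l: "s \<longlonglongrightarrow> l"
      using Cauchy_convergent_iff convergent_def by blast
    have sl: "norm (l - s n) \<le> inverse (real (Suc n))" for n
    proof (rule Lim_norm_ubound)
      show "(\<lambda>m. s m - s n) \<longlonglongrightarrow> l - s n" by (intro tendsto_intros l)
      show "\<forall>\<^sub>F m in sequentially. norm (s m - s n) \<le> inverse (real (Suc n))"
        unfolding eventually_sequentially by (intro exI[of _ n] allI impI less_imp_le[OF step])
    qed simp
    have "(f has_sum l) UNIV"
      unfolding has_sum_def
    proof (rule tendstoI)
      fix e :: real assume "0 < e"
      then obtain n where n: "inverse (real (Suc n)) < e / 2"
        using reals_Archimedean[of "e / 2"] by auto
      have "dist (\<Sum>i\<in>G. f i) l < e" if "finite G" "U n \<subseteq> G" for G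
        using close[OF that] sl[of n] n norm_triangle_ineq[of "(\<Sum>i\<in>G. f i) - s n" "s n - l"]
        by (simp add: dist_norm norm_minus_commute)
      then show "\<forall>\<^sub>F G in finite_subsets_at_top UNIV. dist (\<Sum>i\<in>G. f i) l < e"
        unfolding eventually_finite_subsets_at_top by (intro exI[of _ "U n"]) (simp add: finU)
    qed
    then show False using assms by (auto simp: summable_on_def)
  qed
  then obtain e where "0 < e" and e: "\<And>F. finite F \<Longrightarrow> \<exists>G. finite G \<and> G \<inter> F = {} \<and> e \<le> norm (\<Sum>i\<in>G. f i)"
    by blast
  then obtain g where g: "\<And>F. finite F \<Longrightarrow> finite (g F)" "\<And>F. finite F \<Longrightarrow> g F \<inter> F = {}"
    "\<And>F. finite F \<Longrightarrow> e \<le> norm (\<Sum>i\<in>g F. f i)"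
    by metis
  \<comment> \<open>\<open>V n\<close> collects the indices of the first \<open>n\<close>
    blocks.\<close>
  define V where "V n = ((\<lambda>F. F \<union> g F) ^^ n) {}" for n
  have V_Suc: "V (Suc n) = V n \<union> g (V n)" for n
    by (simp add: V_def)
  have finV: "finite (V n)" for n
    by (induction n) (simp_all add: V_Suc g(1), simp add: V_def)
  have "V m \<subseteq> V n" if "m \<le> n" for m n
    by (rule lift_Suc_mono_le[OF _ that]) (simp add: V_Suc)
  then have "g (V m) \<subseteq> V n" if "m < n" for m n
    using V_Suc[of m] that by (metis Suc_leI le_sup_iff subset_refl)
  then have lt: "g (V m) \<inter> g (V n) = {}" if "m < n" for m n
    using g(2)[OF finV[of n]] that by blast
  then have disj: "g (V m) \<inter> g (V n) = {}" if "m \<noteq> n" for m n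
    using that by (metis inf_commute linorder_neqE_nat)
  show thesis
    by (rule that[of e "\<lambda>n. g (V n)", OF \<open>0 < e\<close> g(1)[OF finV] g(3)[OF finV] disj])
qed

section \<open>Homomorphisms with non-zero kernel\<close>

context surjective_algebra_hom
begin

text \<open>A rank-one operator factors through any non-zero \<open>S\<close>: map to a multiple of
  a vector \<open>x\<close> with \<open>S x\<close> non-zero, apply \<open>S\<close>, and read the
  result off with a functional norming \<open>S x\<close>.\<close>

lemma h_rank_one_eq_0:
  assumes "S \<noteq> 0" "h S = 0"
  shows "h (rank_one z f) = 0"
proof -
  obtain x where x: "S x \<noteq> 0"
    using assms(1) by (metis blinfun_eqI zero_blinfun.rep_eq)
  obtain g :: "'a \<Rightarrow>\<^sub>L real" where g: "g (S x) = norm (S x)"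
    by (metis exists_norming_functional)
  have "rank_one z f = (1 / norm (S x)) *\<^sub>R (rank_one z g o\<^sub>L (S o\<^sub>L rank_one x f))"
    by (rule blinfun_eqI) (simp add: blinfun.scaleR_left blinfun.scaleR_right g x)
  then have "h (rank_one z f) = (1 / norm (S x)) *\<^sub>R (h (rank_one z g) o\<^sub>L (h S o\<^sub>L h (rank_one x f)))"
    by (simp add: h.scale mult_h)
  then show ?thesis using assms(2) by (simp add: blinfun_eqI)
qed

text \<open>Induction on the size of the spanning set. The projection \<open>R\<close> kills
  \<open>b\<close>, so the range of \<open>R\<close> after \<open>T\<close> lies in the span of
  fewer vectors, and \<open>T\<close> differs from this composite by a rank-one operator.\<close>

lemma h_finite_rank_eq_0:
  assumes S: "S \<noteq> 0" "h S = 0" and "finite B" and "range (blinfun_apply T) \<subseteq> span B"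
  shows "h T = 0"
  using assms(3,4)
proof (induction "card B" arbitrary: B T rule: less_induct)
  case less
  show ?case
  proof (cases "B \<subseteq> {0}")
    case True
    then have "span B \<subseteq> {0}"
      by (metis span_minimal subspace_single_0)
    then have "T = 0"
      using less.prems by (intro blinfun_eqI) auto
    then show ?thesis by (simp add: h.zero)
  next
    case False
    then obtain b where b: "b \<in> B" "b \<noteq> 0" by blast
    obtain g :: "'a \<Rightarrow>\<^sub>L real" where g: "g b = norm b"
      by (metis exists_norming_functional)
    define f where "f = (1 / norm b) *\<^sub>R g"
    have f: "f b = 1" using g b by (simp add: f_def blinfun.scaleR_left)
    define R where "R = id_blinfun - rank_one b f"
    have Rb: "R b = 0" by (simp add: R_def blinfun.diff_left f)
    have T: "T = (R o\<^sub>L T) + rank_one b (f o\<^sub>L T)"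
      by (rule blinfun_eqI) (simp add: R_def blinfun.diff_left blinfun.add_left)
    have linR: "linear R"
      by (simp add: blinfun.bounded_linear_right bounded_linear.linear)
    have "R ` B \<subseteq> insert 0 (R ` (B - {b}))"
      using Rb by auto
    then have "span (R ` B) \<subseteq> span (R ` (B - {b}))"
      by (metis span_insert_0 span_mono)
    then have "R ` span B \<subseteq> span (R ` (B - {b}))"
      by (simp add: linear_span_image[OF linR])
    then have "range (blinfun_apply (R o\<^sub>L T)) \<subseteq> span (R ` (B - {b}))"
      using less.prems(2) by auto
    moreover have "card (R ` (B - {b})) < card B"
      using less.prems(1) b(1) card_image_le[of "B - {b}" R] card_Diff1_less[of B b] by simp
    ultimately have "h (R o\<^sub>L T) = 0"
      using less.prems(1) by (intro less.hyps[of "R ` (B - {b})"]) auto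
    then show ?thesis
      using T h_rank_one_eq_0[OF S] h.add by (metis add_0)
  qed
qed

end

section \<open>Orthogonal idempotents on \<open>Y\<close> from a non-zero kernel\<close>

locale noninjective_algebra_hom = unconditional_fdd X + surjective_algebra_hom h
  for X :: "nat \<Rightarrow> 'a::banach set" and h :: "('a \<Rightarrow>\<^sub>L 'a) \<Rightarrow> ('b::banach \<Rightarrow>\<^sub>L 'b)" +
  fixes N :: "'i \<Rightarrow> nat set" and p :: real
  assumes noninjective: "\<exists>S. S \<noteq> 0 \<and> h S = 0"
    and almost_disjoint: "\<gamma> \<noteq> \<delta> \<Longrightarrow> finite (N \<gamma> \<inter> N \<delta>)"
    and complemented_copy:
      "\<exists>W. complemented_in W (closed_span (\<Union>n\<in>N \<gamma>. X n)) \<and> space_isomorphic_to W"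
    and p_pos: "0 < p"
    and lower_estimate: "disjoint_lower_estimate X p"
begin

lemma h_band_proj_finite:
  assumes "finite A"
  shows "h (band_proj A) = 0"
proof -
  obtain S where S: "S \<noteq> 0" "h S = 0" using noninjective by blast
  obtain B where fin: "\<And>n. finite (B n)" and B: "\<And>n. X n = span (B n)"
    using finite_dimensional by metis
  show ?thesis
  proof (rule h_finite_rank_eq_0[OF S])
    show "finite (\<Union>n\<in>A. B n)" using assms fin by blast
    have "proj n x \<in> span (\<Union>n\<in>A. B n)" if "n \<in> A" for n x
      using proj_in[of n x] span_mono[of "B n" "\<Union>n\<in>A. B n"] that unfolding B by blast
    then show "range (blinfun_apply (band_proj A)) \<subseteq> span (\<Union>n\<in>A. B n)"
      using assms by (auto simp: band_proj_apply intro!: span_sum)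
  qed
qed

text \<open>Since \<open>h\<close> does not see finite changes of the index set, almost disjoint
  sets can be treated as disjoint ones.\<close>

lemma h_band_proj_Diff:
  assumes "finite D"
  shows "h (band_proj (A - D)) = h (band_proj A)"
proof -
  have "band_proj A = band_proj (A - D) + band_proj (A \<inter> D)"
  proof -
    have "(A - D) \<inter> (A \<inter> D) = {}" "(A - D) \<union> (A \<inter> D) = A" by blast+
    then show ?thesis using band_proj_Un[of "A - D" "A \<inter> D"] by metis
  qed
  then show ?thesis
    using assms by (simp add: h.add h_band_proj_finite)
qed

definition Q :: "'i \<Rightarrow> 'b \<Rightarrow>\<^sub>L 'b"
  where "Q \<gamma> = h (band_proj (N \<gamma>))"

lemma Q_apply_Q: "Q \<gamma> (Q \<delta> y) = (if \<gamma> = \<delta> then Q \<gamma> y else 0)"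
proof -
  have "Q \<gamma> (Q \<delta> y) = h (band_proj (N \<gamma> \<inter> N \<delta>)) y"
    by (simp add: Q_def flip: band_proj_compose mult_h)
       (simp add: mult_h)
  then show ?thesis
    by (simp add: Q_def h_band_proj_finite almost_disjoint)
qed

text \<open>\<open>J\<close> embeds the space onto the complemented copy \<open>W\<close> inside the
  band; \<open>L\<close> projects onto the band, then onto \<open>W\<close>, and inverts the
  embedding.\<close>

lemma identity_factors:
  obtains L J :: "'a \<Rightarrow>\<^sub>L 'a" where "L o\<^sub>L (band_proj (N \<gamma>) o\<^sub>L J) = id_blinfun"
proof -
  define Z where "Z = closed_span (\<Union>n\<in>N \<gamma>. X n)"
  obtain W where "complemented_in W Z" "space_isomorphic_to W"
    using complemented_copy unfolding Z_def by blast
  obtain R K where Radd: "\<And>x y. x \<in> Z \<Longrightarrow> y \<in> Z \<Longrightarrow> R (x + y) = R x + R y"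
    and Rscale: "\<And>c x. x \<in> Z \<Longrightarrow> R (c *\<^sub>R x) = c *\<^sub>R R x"
    and Rbound: "\<And>x. x \<in> Z \<Longrightarrow> norm (R x) \<le> K * norm x"
    and RW: "R ` Z = W" "W \<subseteq> Z" "\<And>w. w \<in> W \<Longrightarrow> R w = w"
    using \<open>complemented_in W Z\<close> unfolding complemented_in_def by metis
  obtain T T' :: "'a \<Rightarrow> 'a" where T: "linear T" and hom: "homeomorphism UNIV W T T'"
    using \<open>space_isomorphic_to W\<close> unfolding space_isomorphic_to_def by blast
  have T'T: "T' (T x) = x" for x
    using hom by (simp add: homeomorphism_def)
  have TT': "T (T' w) = w" if "w \<in> W" for w
    using hom that by (simp add: homeomorphism_def)
  have TW: "T x \<in> W" for x
    using hom by (auto simp: homeomorphism_def)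
  have T'add: "T' (v + w) = T' v + T' w" if "v \<in> W" "w \<in> W" for v w
    by (metis TT' that T'T linear_add[OF T])
  have T'scale: "T' (c *\<^sub>R w) = c *\<^sub>R T' w" if "w \<in> W" for c w
    by (metis TT' that T'T linear_scale[OF T])
  have "bounded_linear T"
    using hom by (intro linear_continuous_imp_bounded_linear T) (simp add: homeomorphism_def)
  define E where "E = band_proj (N \<gamma>)"
  have EZ: "E x \<in> Z" for x
    unfolding E_def Z_def by (rule band_proj_in_closed_span)
  have EidZ: "E x = x" if "x \<in> Z" for x
    using that unfolding E_def Z_def by (rule band_proj_closed_span)
  \<comment> \<open>\<open>R\<close> is known to be linear only on \<open>Z\<close> and
    \<open>T'\<close> only on \<open>W\<close>; starting with \<open>E\<close> yields a linear map
    on the whole space.\<close>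
  define l where "l x = T' (R (E x))" for x
  have RE: "bounded_linear (\<lambda>x. R (E x))"
  proof (rule bounded_linear_intro[where K = "\<bar>K\<bar> * norm E"])
    show "norm (R (E x)) \<le> norm x * (\<bar>K\<bar> * norm E)" for x
    proof -
      have "norm (R (E x)) \<le> \<bar>K\<bar> * norm (E x)"
        using Rbound[OF EZ[of x]] mult_right_mono[OF abs_ge_self norm_ge_zero] by (rule order_trans)
      also have "\<dots> \<le> \<bar>K\<bar> * (norm E * norm x)"
        by (intro mult_left_mono norm_blinfun) simp
      finally show ?thesis by (simp add: mult_ac)
    qed
  qed (simp_all add: blinfun.add_right blinfun.scaleR_right Radd Rscale EZ)
  have REW: "R (E x) \<in> W" for x
    using RW(1) EZ by blast
  have "linear l"
    by (rule linearI)
      (simp_all add: l_def blinfun.add_right blinfun.scaleR_right Radd Rscale EZ T'add T'scale REW)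
  moreover have "continuous_on UNIV l"
    unfolding l_def
  proof (rule continuous_on_compose2[of W T'])
    show "continuous_on W T'" using hom by (simp add: homeomorphism_def)
    show "continuous_on UNIV (\<lambda>x. R (E x))"
      by (rule linear_continuous_on[OF RE])
  qed (use REW in auto)
  ultimately have bl: "bounded_linear l"
    by (rule linear_continuous_imp_bounded_linear)
  have "l (E (T x)) = x" for x
  proof -
    have "E (T x) = T x" using TW RW(2) by (intro EidZ) blast
    then show ?thesis by (simp add: l_def RW(3) TW T'T)
  qed
  then have "Blinfun l o\<^sub>L (E o\<^sub>L Blinfun T) = id_blinfun"
    by (intro blinfun_eqI) (simp add: bounded_linear_Blinfun_apply bl \<open>bounded_linear T\<close>)
  then show thesis
    using that unfolding E_def by blast
qed

text \<open>If \<open>Q \<gamma>\<close> vanished, applying \<open>h\<close> to the factorization of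
  the identity would make the identity of \<open>Y\<close> zero.\<close>

lemma Q_nonzero: "\<exists>y. Q \<gamma> y \<noteq> 0"
proof (rule ccontr)
  assume "\<not> ?thesis"
  then have "Q \<gamma> = 0" by (intro blinfun_eqI) simp
  obtain L J :: "'a \<Rightarrow>\<^sub>L 'a" where LJ: "L o\<^sub>L (band_proj (N \<gamma>) o\<^sub>L J) = id_blinfun"
    by (rule identity_factors)
  have "id_blinfun = h (L o\<^sub>L (band_proj (N \<gamma>) o\<^sub>L J))"
    by (simp add: LJ h_id)
  also have "\<dots> = h L o\<^sub>L (Q \<gamma> o\<^sub>L h J)"
    by (simp add: mult_h Q_def)
  also have "\<dots> = 0"
    by (simp add: \<open>Q \<gamma> = 0\<close> blinfun_eqI)
  finally have "y = 0" for y :: 'b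
    by (metis blinfun_apply_id_blinfun zero_blinfun.rep_eq)
  then show False using nontrivial by blast
qed

lemma disjointify:
  assumes "finite F"
  obtains D where "finite D"
    "\<And>\<gamma> \<delta>. \<gamma> \<in> F \<Longrightarrow> \<delta> \<in> F \<Longrightarrow> \<gamma> \<noteq> \<delta> \<Longrightarrow> (N \<gamma> - D) \<inter> (N \<delta> - D) = {}"
proof -
  define D where "D = (\<Union>(\<gamma>, \<delta>) \<in> {(\<gamma>, \<delta>) \<in> F \<times> F. \<gamma> \<noteq> \<delta>}. N \<gamma> \<inter> N \<delta>)"
  have "finite {(\<gamma>, \<delta>) \<in> F \<times> F. \<gamma> \<noteq> \<delta>}"
    by (rule finite_subset[OF _ finite_cartesian_product[OF assms assms]]) auto
  then have "finite D"
    unfolding D_def by (intro finite_UN_I) (auto intro: almost_disjoint)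
  moreover have "(N \<gamma> - D) \<inter> (N \<delta> - D) = {}" if "\<gamma> \<in> F" "\<delta> \<in> F" "\<gamma> \<noteq> \<delta>" for \<gamma> \<delta>
    using that by (auto simp: D_def)
  ultimately show thesis by (rule that)
qed

text \<open>Finite sums of the idempotents thus lift to a single band projection, whose norm is
  bounded independently of the number of summands.\<close>

lemma sum_Q:
  assumes "finite D" "finite G"
    and "\<And>\<gamma> \<delta>. \<gamma> \<in> G \<Longrightarrow> \<delta> \<in> G \<Longrightarrow> \<gamma> \<noteq> \<delta> \<Longrightarrow> (N \<gamma> - D) \<inter> (N \<delta> - D) = {}"
  shows "(\<Sum>\<gamma>\<in>G. Q \<gamma>) = h (band_proj (\<Union>\<gamma>\<in>G. N \<gamma> - D))"
proof -
  have "band_proj (\<Union>\<gamma>\<in>G. N \<gamma> - D) = (\<Sum>\<gamma>\<in>G. band_proj (N \<gamma> - D))"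
    using assms(2,3) by (rule band_proj_UN)
  then show ?thesis
    by (simp add: h.sum Q_def h_band_proj_Diff[OF assms(1)])
qed

lemma norm_sum_Q_le:
  obtains K where "\<And>F. finite F \<Longrightarrow> norm (\<Sum>\<gamma>\<in>F. Q \<gamma>) \<le> K"
proof -
  obtain K where K: "\<And>A. norm (band_proj A) \<le> K"
    by (rule norm_band_proj_le) blast
  obtain H where H: "0 < H" "\<And>a. norm (h a) \<le> norm a * H"
    using bounded_linear.pos_bounded[OF bounded_linear_h] by blast
  have "norm (\<Sum>\<gamma>\<in>F. Q \<gamma>) \<le> K * H" if F: "finite F" for F
  proof -
    obtain D where D: "finite D"
      "\<And>\<gamma> \<delta>. \<gamma> \<in> F \<Longrightarrow> \<delta> \<in> F \<Longrightarrow> \<gamma> \<noteq> \<delta> \<Longrightarrow> (N \<gamma> - D) \<inter> (N \<delta> - D) = {}"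
      using disjointify[OF F] by blast
    have "norm (\<Sum>\<gamma>\<in>F. Q \<gamma>) \<le> norm (band_proj (\<Union>\<gamma>\<in>F. N \<gamma> - D)) * H"
      using sum_Q[OF D(1) F] D(2) H(2) by metis
    also have "\<dots> \<le> K * H"
      using K H(1) by (intro mult_right_mono) auto
    finally show ?thesis .
  qed
  then show thesis by (rule that)
qed

text \<open>The lower \<open>p\<close> estimate is used in this form: the sum of the norms of
  \<open>k\<close> disjoint blocks is sublinear in \<open>k\<close>. Blocks of norm at most
  \<open>\<delta> * norm x\<close> contribute at most \<open>k * \<delta> * norm x\<close>; the
  number of larger ones is bounded independently of \<open>k\<close>.\<close>

lemma sum_norm_band_proj_le:
  assumes "\<delta> > 0"
  obtains M where "0 < M"
    "\<And>(k::nat) A x. (\<And>i j. i < k \<Longrightarrow> j < k \<Longrightarrow> i \<noteq> j \<Longrightarrow> A i \<inter> A j = {}) \<Longrightarrow>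
      (\<Sum>i<k. norm (band_proj (A i) x)) \<le> (real k * \<delta> + M) * norm x"
proof -
  obtain K where K: "0 < K" "\<And>A. norm (band_proj A) \<le> K"
    by (rule norm_band_proj_le) blast
  obtain C where C: "C > 0" and lower:
    "\<And>(k::nat) (x :: nat \<Rightarrow> 'a). (\<And>n. \<exists>\<^sub>\<le>\<^sub>1 i. i < k \<and> proj n (x i) \<noteq> 0) \<Longrightarrow>
        1 / C * (\<Sum>i<k. norm (x i) powr p) powr (1 / p) \<le> norm (\<Sum>i<k. x i)"
    using lower_estimate unfolding disjoint_lower_estimate_def by blast
  \<comment> \<open>\<open>(C * K / \<delta>) powr p\<close> bounds the number of blocks larger than
    \<open>\<delta> * norm x\<close>, and each block has norm at most
    \<open>K * norm x\<close>.\<close>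
  define M where "M = K * (C * K / \<delta>) powr p"
  have M: "0 < M" using K(1) C assms by (simp add: M_def)
  have "(\<Sum>i<k. norm (band_proj (A i) x)) \<le> (real k * \<delta> + M) * norm x"
    if disj: "\<And>i j. i < k \<Longrightarrow> j < k \<Longrightarrow> i \<noteq> j \<Longrightarrow> A i \<inter> A j = {}" for k :: nat and A x
  proof (cases "x = 0")
    case True
    then show ?thesis by (simp add: blinfun.zero_right)
  next
    case False
    define t where "t i = norm (band_proj (A i) x)" for i
    have Kx: "norm (band_proj B x) \<le> K * norm x" for B
      by (rule order_trans[OF norm_blinfun mult_right_mono[OF K(2)]]) simp
    have "(\<Sum>i<k. t i powr p) powr (1 / p) \<le> C * norm (\<Sum>i<k. band_proj (A i) x)"
    proof -
      have "\<exists>\<^sub>\<le>\<^sub>1 i. i < k \<and> proj n (band_proj (A i) x) \<noteq> 0" for n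
        unfolding Uniq_def proj_band_proj using disj by (metis disjoint_iff)
      from lower[of k "\<lambda>i. band_proj (A i) x", OF this] show ?thesis
        using C by (simp add: t_def field_simps)
    qed
    also have "(\<Sum>i<k. band_proj (A i) x) = band_proj (\<Union>i<k. A i) x"
      using disj by (subst band_proj_UN) (auto simp: blinfun.sum_left)
    also have "C * norm \<dots> \<le> C * (K * norm x)"
      using C Kx by (intro mult_left_mono) auto
    finally have "((\<Sum>i<k. t i powr p) powr (1 / p)) powr p \<le> (C * (K * norm x)) powr p"
      using p_pos by (intro powr_mono2) auto
    then have sum_le: "(\<Sum>i<k. t i powr p) \<le> (C * (K * norm x)) powr p"
      using p_pos by (simp add: powr_powr sum_nonneg)
    \<comment> \<open>As in Chebyshev's inequality, the quotient of powers is at least 1 on large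
      blocks and non-negative on the others.\<close>
    have split: "t i \<le> \<delta> * norm x + K * norm x * (t i powr p / (\<delta> * norm x) powr p)" for i
    proof (cases "t i \<le> \<delta> * norm x")
      case True
      have "0 \<le> K * norm x * (t i powr p / (\<delta> * norm x) powr p)"
        using K(1) by simp
      then show ?thesis using True by linarith
    next
      case large: False
      have "(\<delta> * norm x) powr p \<le> t i powr p"
        using large p_pos assms by (intro powr_mono2) auto
      then have "1 \<le> t i powr p / (\<delta> * norm x) powr p"
        using assms False by simp
      then have "K * norm x * 1 \<le> K * norm x * (t i powr p / (\<delta> * norm x) powr p)"
        using K(1) by (intro mult_left_mono) auto
      moreover have "t i \<le> K * norm x"
        unfolding t_def by (rule Kx)
      moreover have "0 \<le> \<delta> * norm x" using assms by simp
      ultimately show ?thesis by linarith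
    qed
    have "(\<Sum>i<k. t i) \<le> (\<Sum>i<k. \<delta> * norm x + K * norm x * (t i powr p / (\<delta> * norm x) powr p))"
      by (rule sum_mono) (rule split)
    also have "\<dots> = k * \<delta> * norm x + K * norm x * ((\<Sum>i<k. t i powr p) / (\<delta> * norm x) powr p)"
      by (simp add: sum.distrib sum_distrib_left sum_divide_distrib)
    also have "\<dots> \<le> k * \<delta> * norm x + K * norm x * ((C * (K * norm x)) powr p / (\<delta> * norm x) powr p)"
      using K(1) by (intro add_left_mono mult_left_mono divide_right_mono sum_le) auto
    also have "(C * (K * norm x)) powr p / (\<delta> * norm x) powr p = (C * K / \<delta>) powr p"
      using K(1) C assms False by (simp add: powr_divide[symmetric])
    finally show ?thesis
      by (simp add: t_def M_def algebra_simps)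
  qed
  then show thesis using that M by blast
qed

text \<open>Composing the blocks with rank-one operators into a fixed direction moves the lower
  estimate to \<open>Y\<close>: lifts of these operators act on \<open>X\<close>, where the sum over \<open>k\<close>
  disjoint blocks has norm \<open>o(k)\<close>.\<close>

lemma Q_summable_on: "(\<lambda>\<gamma>. Q \<gamma> y) summable_on A"
proof -
  have "(\<lambda>\<gamma>. Q \<gamma> y) summable_on UNIV"
  proof (rule ccontr)
    assume "\<not> ?thesis"
    then obtain e G where e: "0 < e" and fin: "\<And>n::nat. finite (G n)"
      and large: "\<And>n. e \<le> norm (\<Sum>\<gamma>\<in>G n. Q \<gamma> y)"
      and disj: "\<And>m n. m \<noteq> n \<Longrightarrow> G m \<inter> G n = {}"
      by (rule not_summable_on_imp_blocks) blast
    obtain H where H: "0 < H" "\<And>a. norm (h a) \<le> norm a * H"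
      using bounded_linear.pos_bounded[OF bounded_linear_h] by blast
    obtain L where L: "0 < L" "\<And>b. \<exists>a. h a = b \<and> norm a \<le> L * norm b"
      by (rule open_mapping_bound[OF bounded_linear_h surj_h]) blast
    obtain z :: 'b where z: "norm z = 1"
    proof -
      obtain w :: 'b where "w \<noteq> 0" using nontrivial by blast
      then show thesis by (intro that[of "sgn w"]) (simp add: norm_sgn)
    qed
    have "\<exists>f :: 'b \<Rightarrow>\<^sub>L real. norm f \<le> 1 \<and> blinfun_apply f v = norm v" for v
      by (metis exists_norming_functional)
    then obtain f :: "'b \<Rightarrow> 'b \<Rightarrow>\<^sub>L real" where f: "\<And>v. norm (f v) \<le> 1" "\<And>v. blinfun_apply (f v) v = norm v"
      by metis
    define E where "E i = (\<Sum>\<gamma>\<in>G i. Q \<gamma>)" for i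
    have Ey: "e \<le> norm (E i y)" for i
      using large[of i] by (simp add: E_def blinfun.sum_left)
    \<comment> \<open>The open mapping bound gives lifts of norm at most \<open>L\<close> for all
      \<open>i\<close> at once.\<close>
    have "\<exists>a. h a = rank_one z (f (E i y)) \<and> norm a \<le> L" for i
    proof -
      have "norm (rank_one z (f (E i y))) \<le> 1"
        using norm_rank_one_le[of z "f (E i y)"] f(1)[of "E i y"] z by simp
      then have "L * norm (rank_one z (f (E i y))) \<le> L * 1"
        using L(1) by (intro mult_left_mono) auto
      then show ?thesis
        using L(2)[of "rank_one z (f (E i y))"] by force
    qed
    then obtain S where S: "\<And>i. h (S i) = rank_one z (f (E i y))" "\<And>i. norm (S i) \<le> L"
      by metis
    \<comment> \<open>With this choice \<open>\<delta> * (H * L * norm y)\<close> is at most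
      \<open>e / 2\<close>, half of what each block contributes; \<open>norm y + 1\<close> keeps
      \<open>c\<close> positive when \<open>y = 0\<close>.\<close>
    define c where "c = H * L * (norm y + 1)"
    define \<delta> where "\<delta> = e / (2 * c)"
    have pos: "0 < c"
      unfolding c_def by (intro mult_pos_pos add_nonneg_pos) (use H(1) L(1) in auto)
    then have \<delta>: "0 < \<delta>" using e by (simp add: \<delta>_def)
    obtain M where M: "0 < M"
      "\<And>(k::nat) A x. (\<And>i j. i < k \<Longrightarrow> j < k \<Longrightarrow> i \<noteq> j \<Longrightarrow> A i \<inter> A j = {}) \<Longrightarrow>
        (\<Sum>i<k. norm (band_proj (A i) x)) \<le> (real k * \<delta> + M) * norm x"
      using sum_norm_band_proj_le[OF \<delta>] by metis
    have bound: "real k * e \<le> 2 * (L * M * H * norm y)" for k :: nat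
    proof -
      obtain D where D: "finite D" "\<And>\<gamma> \<delta>. \<gamma> \<in> (\<Union>i<k. G i) \<Longrightarrow> \<delta> \<in> (\<Union>i<k. G i) \<Longrightarrow> \<gamma> \<noteq> \<delta> \<Longrightarrow>
          (N \<gamma> - D) \<inter> (N \<delta> - D) = {}"
        using disjointify[of "\<Union>i<k. G i"] fin by (metis finite_UN finite_lessThan)
      define A where "A i = (\<Union>\<gamma>\<in>G i. N \<gamma> - D)" for i
      have E: "E i = h (band_proj (A i))" if "i < k" for i
        unfolding E_def A_def by (rule sum_Q[OF D(1) fin D(2)]) (use that in blast)+
      have "A i \<inter> A j = {}" if "i < k" "j < k" "i \<noteq> j" for i j
      proof -
        have "(N \<gamma> - D) \<inter> (N \<gamma>' - D) = {}" if "\<gamma> \<in> G i" "\<gamma>' \<in> G j" for \<gamma> \<gamma>'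
        proof (rule D(2))
          show "\<gamma> \<noteq> \<gamma>'" using disj[OF \<open>i \<noteq> j\<close>] that by blast
        qed (use that \<open>i < k\<close> \<open>j < k\<close> in blast)+
        then show ?thesis by (auto simp: A_def)
      qed
      note sum_le = M(2)[of k A, OF this]
      define U where "U = (\<Sum>i<k. S i o\<^sub>L band_proj (A i))"
      have "norm U \<le> L * (real k * \<delta> + M)"
      proof (rule norm_blinfun_bound)
        show "0 \<le> L * (real k * \<delta> + M)"
          using L(1) \<delta> M(1) by simp
        fix x
        have "norm (U x) \<le> (\<Sum>i<k. norm (S i (band_proj (A i) x)))"
          by (simp add: U_def blinfun.sum_left norm_sum)
        also have "\<dots> \<le> (\<Sum>i<k. L * norm (band_proj (A i) x))"
          by (intro sum_mono order_trans[OF norm_blinfun] mult_right_mono S(2)) simp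
        also have "\<dots> \<le> L * ((real k * \<delta> + M) * norm x)"
          unfolding sum_distrib_left[symmetric] using L(1) by (intro mult_left_mono sum_le) simp_all
        finally show "norm (U x) \<le> L * (real k * \<delta> + M) * norm x" by (simp add: mult_ac)
      qed
      then have hU: "norm (h U) \<le> L * (real k * \<delta> + M) * H"
        using H(2)[of U] H(1) by (meson mult_right_mono less_imp_le order_trans)
      \<comment> \<open>All terms are non-negative multiples of \<open>z\<close>, so nothing cancels
        and the norm is at least \<open>k * e\<close>, whereas the bound on \<open>h U\<close>
        allows only about \<open>k * e / 2\<close> plus a constant.\<close>
      have "h U y = (\<Sum>i<k. norm (E i y) *\<^sub>R z)"
        by (simp add: U_def h.sum mult_h S(1) E[symmetric] blinfun.sum_left f(2))
      then have "norm (h U y) = (\<Sum>i<k. norm (E i y))"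
        using z by (simp add: sum_nonneg flip: scaleR_sum_left)
      then have "real k * e \<le> norm (h U y)"
        using sum_mono[of "{..<k}" "\<lambda>_. e" "\<lambda>i. norm (E i y)"] Ey by simp
      also have "\<dots> \<le> norm (h U) * norm y"
        by (rule norm_blinfun)
      also have "\<dots> \<le> L * (real k * \<delta> + M) * H * norm y"
        by (intro mult_right_mono hU) simp
      also have "\<dots> = real k * (\<delta> * (H * L * norm y)) + L * M * H * norm y"
        by (simp add: algebra_simps)
      finally have le: "real k * e \<le> real k * (\<delta> * (H * L * norm y)) + L * M * H * norm y" .
      have "\<delta> * (H * L * norm y) \<le> \<delta> * c"
        unfolding c_def using \<delta> H(1) L(1) by (intro mult_left_mono) auto
      also have "\<delta> * c = e / 2"
        using pos by (simp add: \<delta>_def)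
      finally have "real k * (\<delta> * (H * L * norm y)) \<le> real k * (e / 2)"
        by (intro mult_left_mono) auto
      then show ?thesis using le by simp
    qed
    obtain k :: nat where "2 * (L * M * H * norm y) / e < real k"
      using reals_Archimedean2 by blast
    then show False
      using bound[of k] e by (simp add: field_simps)
  qed
  then show ?thesis
    by (rule summable_on_subset_banach) simp
qed

section \<open>Operators on \<open>Y\<close> indexed by sets of idempotents\<close>

definition selector :: "'i set \<Rightarrow> 'b \<Rightarrow>\<^sub>L 'b"
  where "selector A = Blinfun (\<lambda>y. \<Sum>\<^sub>\<infinity>\<gamma>\<in>A. Q \<gamma> y)"

lemma selector_apply: "selector A y = (\<Sum>\<^sub>\<infinity>\<gamma>\<in>A. Q \<gamma> y)"
proof -
  obtain K where K: "\<And>F. finite F \<Longrightarrow> norm (\<Sum>\<gamma>\<in>F. Q \<gamma>) \<le> K"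
    by (rule norm_sum_Q_le) blast
  have "norm (\<Sum>\<^sub>\<infinity>\<gamma>\<in>A. Q \<gamma> y) \<le> K * norm y" for y
  proof (rule Lim_norm_ubound[OF _ infsum_tendsto[OF Q_summable_on]])
    have "norm (\<Sum>\<gamma>\<in>F. Q \<gamma> y) \<le> K * norm y" if "finite F" for F
      using order_trans[OF norm_blinfun mult_right_mono[OF K[OF that] norm_ge_zero]]
      by (simp add: blinfun.sum_left)
    then show "\<forall>\<^sub>F F in finite_subsets_at_top A. norm (\<Sum>\<gamma>\<in>F. Q \<gamma> y) \<le> K * norm y"
      by (auto simp: eventually_finite_subsets_at_top)
  qed simp
  then have "bounded_linear (\<lambda>y. \<Sum>\<^sub>\<infinity>\<gamma>\<in>A. Q \<gamma> y)"
    by (intro bounded_linear_intro[where K = K])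
      (simp_all add: blinfun.add_right blinfun.scaleR_right infsum_add infsum_scaleR_right
        Q_summable_on mult.commute)
  then show ?thesis
    by (simp add: selector_def bounded_linear_Blinfun_apply)
qed

text \<open>The set \<open>A\<close> is recovered as the set of those \<open>\<gamma>\<close> for
  which \<open>selector A\<close> is non-zero on the range of \<open>Q \<gamma>\<close>.\<close>

lemma inj_selector: "inj selector"
proof -
  have sel: "selector A (Q \<gamma> y) = (if \<gamma> \<in> A then Q \<gamma> y else 0)" for A \<gamma> y
  proof -
    have "((\<lambda>\<delta>. Q \<delta> (Q \<gamma> y)) has_sum (\<Sum>\<delta>\<in>A \<inter> {\<gamma>}. Q \<delta> (Q \<gamma> y))) (A \<inter> {\<gamma>})"
      by (rule has_sum_finite) simp
    then have "((\<lambda>\<delta>. Q \<delta> (Q \<gamma> y)) has_sum (\<Sum>\<delta>\<in>A \<inter> {\<gamma>}. Q \<delta> (Q \<gamma> y))) A"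
      by (rule iffD1[OF has_sum_cong_neutral, rotated -1]) (auto simp: Q_apply_Q)
    then have "selector A (Q \<gamma> y) = (\<Sum>\<delta>\<in>A \<inter> {\<gamma>}. Q \<delta> (Q \<gamma> y))"
      unfolding selector_apply by (rule infsumI)
    then show ?thesis
      by (cases "\<gamma> \<in> A") (simp_all add: Q_apply_Q)
  qed
  have "A = {\<gamma>. \<exists>y. selector A (Q \<gamma> y) \<noteq> 0}" for A
    using Q_nonzero by (auto simp: sel)
  then show ?thesis
    by (metis injI)
qed

end

theorem theorem2p6:
  fixes X :: "nat \<Rightarrow> 'a::banach set"
    and p :: real
  assumes "unconditional_FDD X"
    and "property_sharp' X"
    and "0 < p"
    and "disjoint_lower_estimate X p"
    and "\<exists>y::'b::banach. y \<noteq> 0"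
  shows "\<forall>h :: ('a \<Rightarrow>\<^sub>L 'a) \<Rightarrow> ('b \<Rightarrow>\<^sub>L 'b). algebra_hom h \<and> surj h \<longrightarrow> inj h"
proof (intro allI impI)
  fix h :: "('a \<Rightarrow>\<^sub>L 'a) \<Rightarrow> ('b \<Rightarrow>\<^sub>L 'b)"
  assume h: "algebra_hom h \<and> surj h"
  then have lin: "linear h" by (simp add: algebra_hom_def)
  obtain N :: "real \<Rightarrow> nat set" where N: "\<And>\<gamma> \<delta>. \<gamma> \<noteq> \<delta> \<Longrightarrow> finite (N \<gamma> \<inter> N \<delta>)"
    "\<And>\<gamma>. \<exists>W. complemented_in W (closed_span (\<Union>n\<in>N \<gamma>. X n)) \<and> space_isomorphic_to W"
    using assms(2) unfolding property_sharp'_def by blast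
  show "inj h"
  proof (rule ccontr)
    assume "\<not> inj h"
    then have "\<exists>S. S \<noteq> 0 \<and> h S = 0"
      using linear_injective_0[OF lin] by blast
    then interpret noninjective_algebra_hom X h N p
      using assms h lin N
      by unfold_locales (auto simp: unconditional_FDD_def algebra_hom_def linear_add linear_scale)
    obtain \<phi> :: "('a \<Rightarrow>\<^sub>L 'a) \<Rightarrow> real" where "inj \<phi>"
      using inj_operators_to_real by blast
    moreover have "inj (inv h)"
      using h by (simp add: surj_imp_inj_inv)
    \<comment> \<open>\<open>inv h\<close> picks a preimage of each operator on \<open>Y\<close>, so
      the composite would inject the sets of reals into the reals.\<close>
    ultimately have "inj (\<phi> \<circ> inv h \<circ> selector)"
      using inj_selector by (intro inj_compose)
    then have "surj (inv (\<phi> \<circ> inv h \<circ> selector))"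
      by (rule inj_imp_surj_inv)
    then show False
      using Cantors_theorem[of "UNIV :: real set"] by auto
  qed
qed

end
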